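(* Let $1<\gamma<n$ and $p>0$. The $\gamma$-Laplace equation $$-\Delta_\gamma u(x)=u^p(x),\quad x\in\mathbb{R}^n,$$ has positive classical solutions with $\int_{\mathbb{R}^n}|\nabla u|^\gamma\,dx<\infty$ if and only if $p=\gamma^*-1$, where $\gamma^*=\frac{n\gamma}{n-\gamma}$.
   Context: $\Delta_\gamma u:=\operatorname{div}(|\nabla u|^{\gamma-2}\nabla u)$ is the $\gamma$-Laplacian. A classical solution satisfies the equation pointwise. *)

theory Defs
  imports "HOL-Analysis.Analysis"
begin

definition grad :: "(real^'n \<Rightarrow> real) \<Rightarrow> real^'n \<Rightarrow> real^'n" where
  "grad u x = (\<chi> i. frechet_derivative u (at x) (axis i 1))"

definition divergence :: "(real^'n \<Rightarrow> real^'n) \<Rightarrow> real^'n \<Rightarrow> real" where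
  "divergence V x = (\<Sum>i\<in>UNIV. frechet_derivative V (at x) (axis i 1) $ i)"

text \<open>The field $|\nabla u|^{\gamma-2}\nabla u$.  At a critical point of $u$ it takes the value
  $0$, which for $\gamma > 1$ is its continuous extension also when $\gamma < 2$.\<close>

definition gamma_flux :: "real \<Rightarrow> (real^'n \<Rightarrow> real) \<Rightarrow> real^'n \<Rightarrow> real^'n" where
  "gamma_flux \<gamma> u x = norm (grad u x) powr (\<gamma> - 2) *\<^sub>R grad u x"

definition gamma_laplacian :: "real \<Rightarrow> (real^'n \<Rightarrow> real) \<Rightarrow> real^'n \<Rightarrow> real" where
  "gamma_laplacian \<gamma> u = divergence (gamma_flux \<gamma> u)"

text \<open>The derivatives required to exist are exactly those occurring in the equation: that of $u$
  and that of the field $|\nabla u|^{\gamma-2}\nabla u$.  Asking for $u \in C^2$ would be wrong: for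
  $\gamma > 2$ the solutions $(a + b|x|^{\gamma/(\gamma-1)})^{-(n-\gamma)/\gamma}$ of the critical
  equation are not twice differentiable at the origin.  For $\gamma > 1$, differentiability of the
  field makes the field, hence also $\nabla u$, continuous.  Since $u$ is positive, its real power
  is given by \<^const>\<open>powr\<close>.\<close>

definition positive_classical_solution :: "real \<Rightarrow> real \<Rightarrow> (real^'n \<Rightarrow> real) \<Rightarrow> bool" where
  "positive_classical_solution \<gamma> p u \<longleftrightarrow>
     (\<forall>x. u x > 0) \<and>
     (\<forall>x. u differentiable (at x)) \<and>
     (\<forall>x. gamma_flux \<gamma> u differentiable (at x)) \<and>
     (\<forall>x. - gamma_laplacian \<gamma> u x = u x powr p)"

definition critical_sobolev_exponent :: "nat \<Rightarrow> real \<Rightarrow> real" where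
  "critical_sobolev_exponent n \<gamma> = real n * \<gamma> / (real n - \<gamma>)"

end

theory Submission
  imports Defs
begin

text \<open>Let \<open>u\<close> be a positive solution with gradient \<open>g\<close> and flux \<open>F = |g|^(\<gamma>-2) g\<close>, and put
\<open>E = \<integral> |g|^\<gamma>\<close> and \<open>P = \<integral> u^(p+1)\<close>.  The divergence of \<open>u F\<close> is \<open>|g|^\<gamma> - u^(p+1)\<close>, and the
divergence of the Pohozaev field \<open>(x \<bullet> g) F - (|g|^\<gamma> / \<gamma>) x + (u^(p+1) / (p+1)) x\<close> is
\<open>(1 - n/\<gamma>) |g|^\<gamma> + n/(p+1) u^(p+1)\<close>.  If both divergences integrate to zero over the whole space,
then \<open>E = P\<close> and \<open>(1 - n/\<gamma>) E + n/(p+1) P = 0\<close>; as \<open>P > 0\<close>, this leaves only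
\<open>p + 1 = n \<gamma> / (n - \<gamma>)\<close>.  These are the lemmas \<open>energy_identity\<close> and \<open>finite_energy_exponent\<close>.
Two obstacles have to be overcome.

The first is regularity.  The flux of a classical solution is differentiable, but its derivative need
not be continuous, and \<open>u\<close> need not be twice differentiable where \<open>g\<close> vanishes.
So the divergence theorem is proved for fields that are merely differentiable and have a
continuous divergence (\<open>integral_divergence_zero\<close>).  The argument is Goursat's: a defect in the
divergence theorem would survive repeated subdivision and contradict differentiability at the
limit point.  Refinable B-splines take the place of cubes, so that no integrals over faces occur.
The divergence of the Pohozaev field is computed separately at points with \<open>F \<noteq> 0\<close>, near which \<open>g\<close>
is a smooth function of \<open>F\<close> and the Hessian of \<open>u\<close> is symmetric, and at points with \<open>F = 0\<close>, where
the terms that would involve the Hessian vanish to higher order.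

The second is decay.  The flux through large spheres disappears in the limit as soon as both \<open>u / |x|\<close>
and \<open>|g|\<close> have integrable \<open>\<gamma>\<close>-th powers.  Testing the equation with \<open>u^(1-\<gamma>)\<close>
shows that the average of \<open>u^(p+1-\<gamma>)\<close> over a ball of radius \<open>R\<close> is at most a constant times \<open>R^(-\<gamma>)\<close>
(\<open>cutoff_reaction_le\<close>), hence \<open>u(2^j y)^(p+1-\<gamma>)\<close> tends to zero for almost every \<open>y\<close>.  Along almost
every ray the finite energy bounds the oscillation of \<open>u\<close>.  Together the two facts force \<open>u\<close> to
vanish at infinity along the points \<open>2^j y\<close>, so that \<open>u(y)\<close> is controlled by the gradient on the ray
through \<open>y\<close>; integrating over \<open>y\<close> gives the Hardy inequality (\<open>hardy_inequality\<close>).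

Conversely, for the critical exponent a multiple of the radial function
\<open>(1 + |x|^s)^(-(n-\<gamma>)/\<gamma>)\<close> with \<open>s = \<gamma>/(\<gamma>-1)\<close> is a solution of finite energy
(\<open>radial_solution_exists\<close>).\<close>

section \<open>Quadratic B-splines\<close>

lemma has_real_derivative_truncated_power:
  fixes s :: real
  shows "((\<lambda>s. max 0 s ^ Suc (Suc k)) has_real_derivative real (Suc (Suc k)) * max 0 s ^ Suc k) (at s)"
proof -
  consider "s < 0" | "s > 0" | "s = 0" by linarith
  then show ?thesis
  proof cases
    case 1
    have "((\<lambda>s. 0) has_real_derivative 0) (at s)" by simp
    then have "((\<lambda>s. max 0 s ^ Suc (Suc k)) has_real_derivative 0) (at s)"
      by (rule has_field_derivative_transform_within_open[of _ _ _ "{..<0}"]) (use 1 in auto)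
    then show ?thesis using 1 by simp
  next
    case 2
    have "((\<lambda>s. s ^ Suc (Suc k)) has_real_derivative real (Suc (Suc k)) * s ^ Suc k) (at s)"
      by (rule DERIV_cong[OF DERIV_pow]) simp
    then have "((\<lambda>s. max 0 s ^ Suc (Suc k)) has_real_derivative real (Suc (Suc k)) * s ^ Suc k) (at s)"
      by (rule has_field_derivative_transform_within_open[of _ _ _ "{0<..}"]) (use 2 in auto)
    then show ?thesis using 2 by simp
  next
    case 3
    have "((\<lambda>h::real. max 0 h ^ Suc (Suc k) / h) \<longlongrightarrow> 0) (at 0)"
    proof (rule tendsto_rabs_zero_cancel, rule tendsto_sandwich[of "\<lambda>_. 0" _ _ "\<lambda>h. \<bar>h\<bar> ^ Suc k"])
      have "\<bar>max 0 h ^ Suc (Suc k) / h\<bar> \<le> \<bar>h\<bar> ^ Suc k" for h :: real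
        by (cases "h > 0") (auto simp: max_def intro!: mult_nonpos_nonneg)
      then show "\<forall>\<^sub>F h in at 0. \<bar>max 0 h ^ Suc (Suc k) / h\<bar> \<le> \<bar>h::real\<bar> ^ Suc k" by simp
      show "((\<lambda>h::real. \<bar>h\<bar> ^ Suc k) \<longlongrightarrow> 0) (at 0)"
        by (auto intro!: tendsto_eq_intros)
    qed auto
    then show ?thesis using 3 by (simp add: DERIV_def)
  qed
qed

text \<open>The quadratic B-spline with knots 0, 1, 2, 3, written as the third difference of a truncated power.
In this form the refinement equation below is the factorization
\<open>(1 - z\<^sup>2)^3 = (1 - z)^3 (1 + z)^3\<close>; the weights are the coefficients of \<open>(1 + z)^3 / 4\<close>.\<close>

definition bspline :: "real \<Rightarrow> real" where
  "bspline t = (max 0 t ^ 2 - 3 * max 0 (t - 1) ^ 2 + 3 * max 0 (t - 2) ^ 2 - max 0 (t - 3) ^ 2) / 2"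

definition bspline' :: "real \<Rightarrow> real" where
  "bspline' t = max 0 t - 3 * max 0 (t - 1) + 3 * max 0 (t - 2) - max 0 (t - 3)"

definition refine_weight :: "nat \<Rightarrow> real" where
  "refine_weight k = (if k = 0 \<or> k = 3 then 1/4 else 3/4)"

lemma has_real_derivative_bspline [derivative_intros]:
  "(bspline has_real_derivative bspline' t) (at t)"
proof -
  have D: "((\<lambda>s. max 0 (s - c) ^ 2) has_real_derivative 2 * max 0 (t - c)) (at t)" for c :: real
  proof -
    have "((\<lambda>s. s - c) has_real_derivative 1) (at t)" by (auto intro!: derivative_eq_intros)
    from DERIV_chain2[where f = "\<lambda>s. max 0 s ^ Suc (Suc 0)" and g = "\<lambda>s. s - c",
        OF has_real_derivative_truncated_power this]
    show ?thesis unfolding numeral_2_eq_2 by simp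
  qed
  show ?thesis
    unfolding bspline_def[abs_def] bspline'_def
    by (rule derivative_eq_intros D[of 0, simplified] D refl | simp)+
qed

lemma bspline_outside: "t \<notin> {0..3} \<Longrightarrow> bspline t = 0"
  by (auto simp: bspline_def max_def power2_eq_square algebra_simps)

lemma bspline'_outside: "t \<notin> {0..3} \<Longrightarrow> bspline' t = 0"
  by (auto simp: bspline'_def max_def)

lemma abs_bspline'_le: "\<bar>bspline' t\<bar> \<le> 1"
  by (auto simp: bspline'_def max_def)

lemma abs_bspline_le: "\<bar>bspline t\<bar> \<le> 1"
proof -
  consider "t < 0 \<or> t > 3" | "0 \<le> t" "t \<le> 1" | "1 \<le> t" "t \<le> 2" | "2 \<le> t" "t \<le> 3" by linarith
  then show ?thesis
  proof cases
    case 2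
    then have "bspline t = t^2/2" by (simp add: bspline_def)
    moreover have "0 \<le> t^2" "t^2 \<le> 1" using power_le_one[of t 2] 2 by auto
    ultimately show ?thesis by linarith
  next
    case 3
    then have "bspline t = 3/4 - (t - 3/2)^2"
      by (simp add: bspline_def power2_eq_square field_simps)
    moreover have "(t - 3/2)^2 \<le> (1/2)^2" by (rule abs_le_square_iff[THEN iffD1]) (use 3 in \<open>simp add: abs_if\<close>)
    moreover have "(1/2::real)^2 \<le> 1" "0 \<le> (t - 3/2)^2" by (auto simp: power_le_one)
    ultimately show ?thesis by linarith
  next
    case 4
    then have "bspline t = (3 - t)^2/2"
      by (simp add: bspline_def power2_eq_square algebra_simps)
    moreover have "0 \<le> (3-t)^2" "(3-t)^2 \<le> 1" using power_le_one[of "3-t" 2] 4 by auto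
    ultimately show ?thesis by linarith
  qed (auto simp: bspline_outside)
qed

text \<open>Both sides are combinations of truncated squares: those at half-integer knots cancel on the right.\<close>

lemma bspline_refine: "bspline t = (\<Sum>k\<le>3. refine_weight k * bspline (2 * t - real k))"
proof -
  have p: "max 0 (2 * t - c) ^ 2 = 4 * max 0 (t - c / 2) ^ 2" for c :: real
    by (auto simp: max_def power2_eq_square algebra_simps)
  have s: "(\<Sum>k\<le>3. f k) = f 0 + f 1 + f 2 + f (3::nat)" for f :: "nat \<Rightarrow> real"
    by (simp add: numeral_3_eq_3 numeral_2_eq_2)
  have q: "max 0 (2 * t) ^ 2 = 4 * max 0 t ^ 2" using p[of 0] by simp
  show ?thesis
    unfolding s bspline_def refine_weight_def
    by (simp add: diff_diff_eq p q) (simp add: field_simps)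
qed

lemma sum_refine_weight: "(\<Sum>k\<le>3. refine_weight k) = 2"
  by (simp add: refine_weight_def numeral_3_eq_3 numeral_2_eq_2)

lemma refine_weight_pos: "refine_weight k > 0"
  by (simp add: refine_weight_def)

lemma bspline_mid: "bspline (3/2) = 3/4"
  by (simp add: bspline_def power2_eq_square)

text \<open>The tensor product B-spline on the cube with lower corner \<open>a\<close> and side \<open>3 h\<close>, which serves as a
continuously differentiable substitute for the indicator function of that cube.\<close>

definition bump :: "'a::euclidean_space \<Rightarrow> real \<Rightarrow> 'a \<Rightarrow> real" where
  "bump a h x = (\<Prod>b\<in>Basis. bspline ((x \<bullet> b - a \<bullet> b) / h))"

definition dbump :: "'a::euclidean_space \<Rightarrow> real \<Rightarrow> 'a \<Rightarrow> 'a \<Rightarrow> real" where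
  "dbump a h x v = (\<Sum>b\<in>Basis. bspline' ((x \<bullet> b - a \<bullet> b) / h) * ((v \<bullet> b) / h)
     * (\<Prod>c\<in>Basis - {b}. bspline ((x \<bullet> c - a \<bullet> c) / h)))"

lemma has_derivative_bump: "(bump a h has_derivative dbump a h x) (at x)"
proof -
  have D: "((\<lambda>x. bspline ((x \<bullet> b - a \<bullet> b) / h)) has_derivative
      (\<lambda>v. bspline' ((x \<bullet> b - a \<bullet> b) / h) * ((v \<bullet> b) / h))) (at x)" for b :: 'a
    by (rule has_derivative_eq_rhs[OF has_derivative_compose[OF _
          has_real_derivative_bspline[unfolded has_field_derivative_def]]])
       (auto simp: divide_inverse intro!: derivative_eq_intros)
  show ?thesis
    unfolding bump_def[abs_def] dbump_def[abs_def]
    by (rule has_derivative_prod) (rule D)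
qed

lemma continuous_on_bspline [continuous_intros]:
  "continuous_on S f \<Longrightarrow> continuous_on S (\<lambda>x. bspline (f x))"
  by (auto simp: bspline_def intro!: continuous_intros)

lemma continuous_on_bspline' [continuous_intros]:
  "continuous_on S f \<Longrightarrow> continuous_on S (\<lambda>x. bspline' (f x))"
  by (auto simp: bspline'_def intro!: continuous_intros)

lemma continuous_on_bump: "h \<noteq> 0 \<Longrightarrow> continuous_on S (bump a h)"
  unfolding bump_def[abs_def] by (intro continuous_intros) auto

lemma continuous_on_dbump:
  "h \<noteq> 0 \<Longrightarrow> continuous_on S V \<Longrightarrow> continuous_on S (\<lambda>x. dbump a h x (V x))"
  unfolding dbump_def by (intro continuous_intros) auto

definition bump_cube :: "'a::euclidean_space \<Rightarrow> real \<Rightarrow> 'a set" where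
  "bump_cube a h = cbox a (a + (3 * h) *\<^sub>R One)"

lemma not_in_bump_cubeE:
  assumes "x \<notin> bump_cube a h" "h > 0"
  obtains b where "b \<in> Basis" "(x \<bullet> b - a \<bullet> b) / h \<notin> {0..3}"
  using assms by (auto simp: bump_cube_def mem_box field_simps inner_add_left)

lemma bump_outside:
  assumes "x \<notin> bump_cube a h" "h > 0"
  shows "bump a h x = 0"
proof -
  obtain b where "b \<in> Basis" "(x \<bullet> b - a \<bullet> b) / h \<notin> {0..3}"
    using assms by (rule not_in_bump_cubeE)
  then have "\<exists>b\<in>Basis. bspline ((x \<bullet> b - a \<bullet> b) / h) = 0" using bspline_outside by blast
  then show ?thesis unfolding bump_def by simp
qed

lemma dbump_outside:
  assumes "x \<notin> bump_cube a h" "h > 0"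
  shows "dbump a h x v = 0"
proof -
  obtain b where b: "b \<in> Basis" "(x \<bullet> b - a \<bullet> b) / h \<notin> {0..3}"
    using assms by (rule not_in_bump_cubeE)
  have "bspline' ((x \<bullet> c - a \<bullet> c) / h) * ((v \<bullet> c) / h)
     * (\<Prod>c\<in>Basis - {c}. bspline ((x \<bullet> c - a \<bullet> c) / h)) = 0" if "c \<in> Basis" for c
  proof (cases "c = b")
    case True
    then show ?thesis using bspline'_outside[OF b(2)] by simp
  next
    case False
    then have "\<exists>d\<in>Basis - {c}. bspline ((x \<bullet> d - a \<bullet> d) / h) = 0"
      using b bspline_outside by blast
    then show ?thesis by simp
  qed
  then show ?thesis unfolding dbump_def by (metis (no_types, lifting) sum.neutral)
qed

lemma abs_prod_bspline_le: "finite A \<Longrightarrow> \<bar>\<Prod>c\<in>A. bspline (f c)\<bar> \<le> 1"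
  unfolding abs_prod by (rule prod_le_1) (auto simp: abs_bspline_le)

lemma abs_bump_le: "\<bar>bump a h x\<bar> \<le> 1"
  unfolding bump_def by (rule abs_prod_bspline_le) simp

lemma abs_dbump_le:
  fixes v :: "'a::euclidean_space"
  assumes "h > 0"
  shows "\<bar>dbump a h x v\<bar> \<le> DIM('a) * norm v / h"
proof -
  have "\<bar>dbump a h x v\<bar> \<le> (\<Sum>b\<in>(Basis::'a set). 1 * (norm v / h) * 1)"
    unfolding dbump_def
    by (rule order_trans[OF sum_abs], rule sum_mono, unfold abs_mult)
       (intro mult_mono abs_bspline'_le abs_prod_bspline_le, use assms in
         \<open>auto simp: divide_right_mono Basis_le_norm\<close>)
  then show ?thesis by simp
qed

lemma linear_dbump: "linear (dbump a h x)"
  using has_derivative_bump by (rule has_derivative_linear)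

text \<open>A bump splits into bumps of half the size, as a cube splits into smaller cubes.  The children
overlap, and their weights add up to \<open>2 ^ n\<close>, the number of cubes in an ordinary bisection.\<close>

lemma bump_refine:
  fixes a :: "'a::euclidean_space"
  assumes "h > 0"
  shows "bump a h x = (\<Sum>k\<in>Basis \<rightarrow>\<^sub>E {..3}. (\<Prod>b\<in>Basis. refine_weight (k b)) *
           bump (a + (\<Sum>b\<in>Basis. (h / 2 * real (k b)) *\<^sub>R b)) (h / 2) x)"
proof -
  have "bump a h x = (\<Prod>b\<in>Basis. \<Sum>k\<le>3. refine_weight k * bspline (2 * ((x \<bullet> b - a \<bullet> b) / h) - real k))"
    unfolding bump_def by (subst bspline_refine) simp
  also have "\<dots> = (\<Sum>k\<in>Basis \<rightarrow>\<^sub>E {..3}. \<Prod>b\<in>Basis. refine_weight (k b) *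
       bspline (2 * ((x \<bullet> b - a \<bullet> b) / h) - real (k b)))"
    by (rule prod_sum_PiE) auto
  also have "\<dots> = (\<Sum>k\<in>Basis \<rightarrow>\<^sub>E {..3}. (\<Prod>b\<in>Basis. refine_weight (k b)) *
           bump (a + (\<Sum>b\<in>Basis. (h / 2 * real (k b)) *\<^sub>R b)) (h / 2) x)"
  proof (unfold bump_def prod.distrib[symmetric], intro sum.cong prod.cong refl)
    fix k and b :: 'a assume b: "b \<in> Basis"
    have "2 * ((x \<bullet> b - a \<bullet> b) / h) - real (k b)
        = (x \<bullet> b - (a + (\<Sum>b\<in>Basis. (h / 2 * real (k b)) *\<^sub>R b)) \<bullet> b) / (h / 2)"
      using assms b by (simp add: inner_add_left inner_sum_left_Basis field_simps)
    then show "refine_weight (k b) * bspline (2 * ((x \<bullet> b - a \<bullet> b) / h) - real (k b)) =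
        refine_weight (k b) * bspline ((x \<bullet> b - (a + (\<Sum>b\<in>Basis. (h / 2 * real (k b)) *\<^sub>R b)) \<bullet> b) / (h / 2))"
      by simp
  qed
  finally show ?thesis .
qed

lemma dbump_refine:
  fixes a :: "'a::euclidean_space"
  assumes "h > 0"
  shows "dbump a h x v = (\<Sum>k\<in>Basis \<rightarrow>\<^sub>E {..3}. (\<Prod>b\<in>Basis. refine_weight (k b)) *
           dbump (a + (\<Sum>b\<in>Basis. (h / 2 * real (k b)) *\<^sub>R b)) (h / 2) x v)"
proof -
  have "(bump a h has_derivative (\<lambda>v. \<Sum>k\<in>Basis \<rightarrow>\<^sub>E {..3}. (\<Prod>b\<in>Basis. refine_weight (k b)) *
           dbump (a + (\<Sum>b\<in>Basis. (h / 2 * real (k b)) *\<^sub>R b)) (h / 2) x v)) (at x)"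
    unfolding bump_refine[OF assms, abs_def]
    by (intro has_derivative_sum has_derivative_mult_right has_derivative_bump)
  from has_derivative_unique[OF has_derivative_bump this] show ?thesis by (rule fun_cong)
qed

section \<open>Divergence theorem for differentiable fields\<close>

lemma integrable_continuous_bounded_support:
  fixes f :: "'a::euclidean_space \<Rightarrow> real"
  assumes "continuous_on UNIV f" "bounded S" "\<And>x. x \<notin> S \<Longrightarrow> f x = 0"
  shows "integrable lborel f"
proof -
  have c: "compact (closure S)" using assms(2) by (simp add: compact_closure)
  have "integrable lborel (\<lambda>x. indicator (closure S) x *\<^sub>R f x)"
    using borel_integrable_compact[OF c, of f] assms(1) continuous_on_subset
    by (fastforce simp: indicator_def if_distrib cong: if_cong)
  also have "(\<lambda>x. indicator (closure S) x *\<^sub>R f x) = f"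
    using assms(3) closure_subset[of S] by (auto simp: indicator_def fun_eq_iff)
  finally show ?thesis .
qed

lemma integral_translate:
  fixes f :: "'a::euclidean_space \<Rightarrow> real"
  assumes "f \<in> borel_measurable borel"
  shows "(\<integral>x. f (c + x) \<partial>lborel) = (\<integral>x. f x \<partial>lborel)"
  by (subst (2) lborel_distr_plus[of c, symmetric], subst integral_distr) (use assms in auto)

text \<open>By translation invariance all difference quotients of \<open>f\<close> integrate to zero.  Continuity of the
directional derivative makes them uniformly bounded, so the limit may be taken under the integral.
For a field that is only differentiable this domination fails, whence the subdivision argument below.\<close>

lemma integral_partial_derivative_zero:
  fixes f :: "'a::euclidean_space \<Rightarrow> real"
  assumes f': "\<And>x. (f has_derivative f' x) (at x)"
    and cont: "continuous_on UNIV (\<lambda>x. f' x v)"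
    and S: "bounded S" "\<And>x. x \<notin> S \<Longrightarrow> f x = 0"
  shows "integrable lborel (\<lambda>x. f' x v)" "(\<integral>x. f' x v \<partial>lborel) = 0"
proof -
  have fc: "continuous_on UNIV f"
    using f' by (meson continuous_at_imp_continuous_on has_derivative_continuous)
  have [measurable]: "f \<in> borel_measurable borel" "(\<lambda>x. f' x v) \<in> borel_measurable borel"
    using fc cont by (auto intro: borel_measurable_continuous_onI)
  obtain r where r: "r > 0" "S \<subseteq> cball 0 r"
    using S(1) by (auto simp: bounded_pos subset_iff)
  have f0: "f x = 0" if "norm x > r" for x using S(2) r that by (metis mem_cball_0 not_le subsetD)
  have f'0: "f' x v = 0" if "norm x > r" for x
  proof -
    have "((\<lambda>_. 0::real) has_derivative (\<lambda>_. 0)) (at x)" by simp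
    moreover have "open {x::'a. norm x > r}" by (intro open_Collect_less continuous_intros)
    ultimately have "(f has_derivative (\<lambda>_. 0)) (at x)"
      by (rule has_derivative_transform_within_open) (use that f0 in auto)
    then show ?thesis using has_derivative_unique[OF f'] by metis
  qed
  show int: "integrable lborel (\<lambda>x. f' x v)"
    by (rule integrable_continuous_bounded_support[OF cont bounded_cball[of 0 r]]) (use f'0 in auto)
  let ?K = "cball (0::'a) (r + norm v)"
  have "bounded ((\<lambda>x. f' x v) ` cball 0 (r + 2 * norm v))"
    by (rule compact_imp_bounded, rule compact_continuous_image[OF continuous_on_subset[OF cont]]) auto
  then obtain M where "\<forall>x\<in>cball 0 (r + 2 * norm v). \<bar>f' x v\<bar> \<le> M"
    unfolding bounded_iff by auto
  then have M: "\<bar>f' x v\<bar> \<le> M" if "norm x \<le> r + 2 * norm v" for x using that by simp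
  have M0: "M \<ge> 0" using M[of 0] r by (smt (verit) norm_ge_zero norm_zero)
  define q where "q m x = (f (inverse (real (Suc m)) *\<^sub>R v + x) - f x) / inverse (real (Suc m))" for m x
  have lim: "(\<lambda>m. q m x) \<longlonglongrightarrow> f' x v" for x
  proof -
    have "((\<lambda>t. f (x + t *\<^sub>R v)) has_derivative (\<lambda>t. f' x (t *\<^sub>R v))) (at 0)"
      by (rule has_derivative_compose[of "\<lambda>t. x + t *\<^sub>R v" _ 0 UNIV f "f' x", simplified])
         (auto intro!: derivative_eq_intros f')
    then have "((\<lambda>t. f (x + t *\<^sub>R v)) has_real_derivative f' x v) (at 0)"
      unfolding has_field_derivative_def
      by (rule has_derivative_eq_rhs) (auto simp: fun_eq_iff linear_scale[OF has_derivative_linear[OF f']])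
    then have *: "((\<lambda>t. (f (x + t *\<^sub>R v) - f x) / t) \<longlongrightarrow> f' x v) (at 0)"
      by (simp add: DERIV_def)
    have "filterlim (\<lambda>m. inverse (real (Suc m))) (at 0) sequentially"
      using LIMSEQ_inverse_real_of_nat by (simp add: filterlim_at)
    from filterlim_compose[OF * this] show ?thesis
      unfolding q_def by (simp add: add.commute)
  qed
  have bound: "norm (q m x) \<le> M * indicator ?K x" for m x
  proof (cases "x \<in> ?K")
    case False
    \<comment> \<open>Neither \<open>x\<close> nor the shifted point lies in the support.\<close>
    define t where "t = inverse (real (Suc m))"
    have t: "0 < t" "t \<le> 1" by (auto simp: t_def inverse_le_1_iff)
    have "norm x > r + norm v" using False by auto
    moreover have "norm x \<le> norm (t *\<^sub>R v + x) + norm (t *\<^sub>R v)"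
      using norm_triangle_ineq4[of "t *\<^sub>R v + x" "t *\<^sub>R v"] by simp
    moreover have "norm (t *\<^sub>R v) \<le> norm v" using t by (simp add: mult_left_le_one_le)
    ultimately have "norm (t *\<^sub>R v + x) > r" "norm x > r" by (smt (verit) norm_ge_zero)+
    then have "q m x = 0" unfolding q_def t_def[symmetric] using f0 by simp
    then show ?thesis using False by simp
  next
    case True
    define t where "t = inverse (real (Suc m))"
    have t: "0 < t" "t \<le> 1" by (auto simp: t_def inverse_le_1_iff)
    have D: "((\<lambda>s. f (s *\<^sub>R v + x)) has_real_derivative f' (s *\<^sub>R v + x) v) (at s)" for s
    proof -
      have "((\<lambda>s. f (s *\<^sub>R v + x)) has_derivative (\<lambda>t. f' (s *\<^sub>R v + x) (t *\<^sub>R v))) (at s)"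
        by (rule has_derivative_compose[of "\<lambda>t. t *\<^sub>R v + x" _ s UNIV f "f' (s *\<^sub>R v + x)", simplified])
           (auto intro!: derivative_eq_intros f')
      then show ?thesis
        unfolding has_field_derivative_def
        by (rule has_derivative_eq_rhs) (auto simp: fun_eq_iff linear_scale[OF has_derivative_linear[OF f']])
    qed
    obtain s where s: "0 < s" "s < t" "f (t *\<^sub>R v + x) - f (0 *\<^sub>R v + x) = (t - 0) * f' (s *\<^sub>R v + x) v"
      using MVT2[OF t(1) D] by auto
    have "norm (s *\<^sub>R v + x) \<le> r + 2 * norm v"
    proof -
      have "norm (s *\<^sub>R v) \<le> norm v" using s t by (simp add: mult_left_le_one_le)
      then show ?thesis using True norm_triangle_ineq[of "s *\<^sub>R v" x] by auto
    qed
    then have "\<bar>f' (s *\<^sub>R v + x) v\<bar> \<le> M" by (rule M)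
    then show ?thesis using s(3) t True unfolding q_def t_def[symmetric] by simp
  qed
  have "(\<lambda>m. \<integral>x. q m x \<partial>lborel) \<longlonglongrightarrow> (\<integral>x. f' x v \<partial>lborel)"
  proof (rule integral_dominated_convergence[where w = "\<lambda>x. M * indicator ?K x"])
    show "integrable lborel (\<lambda>x. M * indicator ?K x)"
      using emeasure_bounded_finite[of ?K] by (intro integrable_mult_right integrable_real_indicator) auto
  qed (use lim bound in \<open>auto simp: q_def\<close>)
  moreover have "(\<integral>x. q m x \<partial>lborel) = 0" for m
  proof -
    have fi: "integrable lborel f"
      by (rule integrable_continuous_bounded_support[OF fc bounded_cball[of 0 r]]) (use f0 in auto)
    have fi': "integrable lborel (\<lambda>x. f (c + x))" for c
      using fi by (subst (asm) lborel_distr_plus[of c, symmetric]) (simp add: integrable_distr_eq)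
    show ?thesis unfolding q_def using fi fi' by (simp add: integral_translate)
  qed
  ultimately show "(\<integral>x. f' x v \<partial>lborel) = 0" by (simp add: LIMSEQ_const_iff)
qed

lemma continuous_on_has_derivative:
  assumes "\<And>x. (f has_derivative f' x) (at x)"
  shows "continuous_on S f"
  using assms by (meson continuous_at_imp_continuous_on has_derivative_continuous)

lemma bounded_bump_cube: "bounded (bump_cube a h)"
  unfolding bump_cube_def by (rule bounded_cbox)

lemma measure_bump_cube:
  fixes a :: "'a::euclidean_space"
  assumes "h > 0"
  shows "measure lborel (bump_cube a h) = (3 * h) ^ DIM('a)"
  unfolding bump_cube_def using assms by (subst content_cbox') (auto simp: box_ne_empty algebra_simps)

lemma integrable_const_bump_cube: "integrable lborel (\<lambda>x. c * indicator (bump_cube a h) x :: real)"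
  unfolding bump_cube_def using emeasure_lborel_cbox_finite
  by (intro integrable_mult_right integrable_real_indicator) auto

lemma norm_diff_bump_cube:
  fixes a :: "'a::euclidean_space" and h :: real
  assumes "x \<in> bump_cube a h" "y \<in> bump_cube a h"
  shows "norm (x - y) \<le> DIM('a) * (3 * h)"
proof -
  have "norm (x - y) \<le> (\<Sum>b\<in>Basis. \<bar>(x - y) \<bullet> b\<bar>)" by (rule norm_le_l1)
  also have "\<dots> \<le> (\<Sum>b\<in>(Basis::'a set). 3 * h)"
    by (rule sum_mono) (use assms in \<open>force simp: bump_cube_def mem_box inner_diff_left inner_add_left abs_le_iff\<close>)
  finally show ?thesis by simp
qed

text \<open>The defect in the divergence theorem for the field \<open>V\<close> with divergence \<open>f\<close>, localized by a bump:
it is the integral of the divergence of the product of \<open>V\<close> with the bump.\<close>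

definition bump_flux :: "('a::euclidean_space \<Rightarrow> 'a) \<Rightarrow> ('a \<Rightarrow> real) \<Rightarrow> 'a \<Rightarrow> real \<Rightarrow> real" where
  "bump_flux V f a h = (\<integral>x. bump a h x * f x + dbump a h x (V x) \<partial>lborel)"

lemma integrable_bump_flux:
  assumes "continuous_on UNIV V" "continuous_on UNIV f" "h > 0"
  shows "integrable lborel (\<lambda>x. bump a h x * f x + dbump a h x (V x))"
  by (rule integrable_continuous_bounded_support[OF _ bounded_bump_cube[of a h]])
     (use assms in \<open>auto intro!: continuous_intros continuous_on_bump continuous_on_dbump
        simp: bump_outside dbump_outside\<close>)

text \<open>The product of a bump with an affine field is continuously differentiable, so here the
elementary version of the divergence theorem applies to each coordinate.\<close>

lemma bump_flux_affine:
  fixes A :: "'a::euclidean_space \<Rightarrow> 'a"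
  assumes "linear A" "h > 0"
  shows "bump_flux (\<lambda>x. v + A (x - x0)) (\<lambda>_. \<Sum>b\<in>Basis. A b \<bullet> b) a h = 0"
proof -
  let ?V = "\<lambda>x. v + A (x - x0)"
  let ?f' = "\<lambda>b x w. bump a h x * (A w \<bullet> b) + dbump a h x w * (?V x \<bullet> b)"
  have bl: "bounded_linear A" using assms(1) by (simp add: linear_conv_bounded_linear)
  have A: "((\<lambda>x. ?V x \<bullet> b) has_derivative (\<lambda>w. A w \<bullet> b)) (at x)" for b x
    by (auto intro!: derivative_eq_intros bounded_linear.has_derivative[OF bl])
  have D: "((\<lambda>x. bump a h x * (?V x \<bullet> b)) has_derivative ?f' b x) (at x)" for b x
    by (rule has_derivative_eq_rhs[OF has_derivative_mult[OF has_derivative_bump A]]) auto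
  have contV: "continuous_on UNIV ?V"
    by (intro continuous_intros bounded_linear.continuous_on[OF bl])
  have C: "continuous_on UNIV (\<lambda>x. ?f' b x b)" for b
    by (intro continuous_intros continuous_on_bump continuous_on_dbump contV) (use assms in auto)
  note I = integral_partial_derivative_zero[OF D C bounded_bump_cube[of a h]]
  have I1: "integrable lborel (\<lambda>x. ?f' b x b)" "(\<integral>x. ?f' b x b \<partial>lborel) = 0" for b
    using I(1)[of b] I(2)[of b] bump_outside[OF _ assms(2)] by auto
  have "bump a h x * (\<Sum>b\<in>Basis. A b \<bullet> b) + dbump a h x (?V x) = (\<Sum>b\<in>Basis. ?f' b x b)" for x
  proof -
    have "dbump a h x (?V x) = dbump a h x (\<Sum>b\<in>Basis. (?V x \<bullet> b) *\<^sub>R b)"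
      by (simp add: euclidean_representation)
    also have "\<dots> = (\<Sum>b\<in>Basis. dbump a h x b * (?V x \<bullet> b))"
      by (simp add: linear_sum[OF linear_dbump] linear_scale[OF linear_dbump] mult.commute)
    finally show ?thesis by (simp add: sum.distrib sum_distrib_left)
  qed
  then have "bump_flux ?V (\<lambda>_. \<Sum>b\<in>Basis. A b \<bullet> b) a h = (\<integral>x. (\<Sum>b\<in>Basis. ?f' b x b) \<partial>lborel)"
    unfolding bump_flux_def by simp
  also have "\<dots> = 0" using I1 by (subst Bochner_Integration.integral_sum) auto
  finally show ?thesis .
qed

lemma bump_flux_refine:
  fixes V :: "'a::euclidean_space \<Rightarrow> 'a"
  assumes "continuous_on UNIV V" "continuous_on UNIV f" "h > 0"
  shows "bump_flux V f a h = (\<Sum>k\<in>Basis \<rightarrow>\<^sub>E {..3}. (\<Prod>b\<in>Basis. refine_weight (k b)) *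
           bump_flux V f (a + (\<Sum>b\<in>Basis. (h / 2 * real (k b)) *\<^sub>R b)) (h / 2))"
proof -
  have "bump a h x * f x + dbump a h x (V x) = (\<Sum>k\<in>Basis \<rightarrow>\<^sub>E {..3}. (\<Prod>b\<in>Basis. refine_weight (k b)) *
     (bump (a + (\<Sum>b\<in>Basis. (h / 2 * real (k b)) *\<^sub>R b)) (h / 2) x * f x
       + dbump (a + (\<Sum>b\<in>Basis. (h / 2 * real (k b)) *\<^sub>R b)) (h / 2) x (V x)))" for x
    by (subst bump_refine[OF assms(3)], subst dbump_refine[OF assms(3)])
       (simp only: sum_distrib_right sum.distrib[symmetric] distrib_left mult.assoc)
  then show ?thesis
    unfolding bump_flux_def using assms
    by (simp add: Bochner_Integration.integral_sum integrable_bump_flux)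
qed

text \<open>Pigeonhole principle: the defect of the parent is the weighted sum of the defects of the children,
and the weights add up to \<open>2 ^ n\<close>, so some child has at least the same defect per volume.\<close>

lemma bump_flux_descend:
  fixes V :: "'a::euclidean_space \<Rightarrow> 'a"
  assumes "continuous_on UNIV V" "continuous_on UNIV f" "h > 0"
    and big: "\<bar>bump_flux V f a h\<bar> \<ge> \<epsilon> * h ^ DIM('a)"
  obtains a' where "\<bar>bump_flux V f a' (h / 2)\<bar> \<ge> \<epsilon> * (h / 2) ^ DIM('a)"
    "bump_cube a' (h / 2) \<subseteq> bump_cube a h"
proof -
  let ?K = "(Basis::'a set) \<rightarrow>\<^sub>E {..(3::nat)}"
  let ?a = "\<lambda>k. a + (\<Sum>b\<in>Basis. (h / 2 * real (k b)) *\<^sub>R b)"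
  let ?w = "\<lambda>k. \<Prod>b\<in>Basis. refine_weight (k b)"
  have w: "?w k > 0" for k by (intro prod_pos) (simp add: refine_weight_pos)
  have fin: "finite ?K" by (intro finite_PiE) auto
  have ne: "?K \<noteq> {}" by (simp add: PiE_eq_empty_iff)
  have sw: "(\<Sum>k\<in>?K. ?w k) = 2 ^ DIM('a)"
    by (subst prod_sum_PiE[symmetric]) (auto simp: sum_refine_weight)
  have "\<exists>k\<in>?K. \<bar>bump_flux V f (?a k) (h / 2)\<bar> \<ge> \<epsilon> * (h / 2) ^ DIM('a)"
  proof (rule ccontr)
    assume "\<not> ?thesis"
    then have lt: "\<bar>bump_flux V f (?a k) (h / 2)\<bar> < \<epsilon> * (h / 2) ^ DIM('a)" if "k \<in> ?K" for k
      using that by force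
    have "\<bar>bump_flux V f a h\<bar> \<le> (\<Sum>k\<in>?K. ?w k * \<bar>bump_flux V f (?a k) (h / 2)\<bar>)"
      unfolding bump_flux_refine[OF assms(1-3), of a]
      by (rule order_trans[OF sum_abs]) (simp add: abs_mult less_imp_le[OF w])
    also have "\<dots> < (\<Sum>k\<in>?K. ?w k * (\<epsilon> * (h / 2) ^ DIM('a)))"
      by (rule sum_strict_mono[OF fin ne], rule mult_strict_left_mono) (use lt w in blast)+
    also have "\<dots> = \<epsilon> * h ^ DIM('a)"
      unfolding sum_distrib_right[symmetric] sw by (simp add: power_divide)
    finally show False using big by simp
  qed
  then obtain k where k: "k \<in> ?K" "\<bar>bump_flux V f (?a k) (h / 2)\<bar> \<ge> \<epsilon> * (h / 2) ^ DIM('a)" by blast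
  moreover have "bump_cube (?a k) (h / 2) \<subseteq> bump_cube a h"
  proof -
    have "real (k b) \<le> 3" if "b \<in> Basis" for b using k(1) that by (auto simp: PiE_iff)
    then have k3: "h / 2 * real (k b) \<le> h / 2 * 3" if "b \<in> Basis" for b
      using that assms(3) by (intro mult_left_mono) auto
    have k0: "0 \<le> h / 2 * real (k b)" for b using assms(3) by simp
    show ?thesis
    proof
      fix x assume x: "x \<in> bump_cube (?a k) (h / 2)"
      have "a \<bullet> b \<le> x \<bullet> b \<and> x \<bullet> b \<le> a \<bullet> b + 3 * h" if b: "b \<in> Basis" for b
      proof -
        have "a \<bullet> b + h / 2 * real (k b) \<le> x \<bullet> b"
          "x \<bullet> b \<le> a \<bullet> b + h / 2 * real (k b) + 3 * (h / 2)"
          using x b by (auto simp: bump_cube_def mem_box inner_add_left inner_sum_left_Basis)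
        then show ?thesis using k0[of b] k3[OF b] by linarith
      qed
      then show "x \<in> bump_cube a h"
        by (auto simp: bump_cube_def mem_box inner_add_left)
    qed
  qed
  ultimately show thesis using that by blast
qed

text \<open>Goursat's argument.  A non-zero defect yields nested cubes of side \<open>3 h / 2 ^ m\<close> whose defect stays
comparable to their volume.  At their common point \<open>V\<close> agrees with an affine field up to an error
\<open>o(h / 2 ^ m)\<close>; since the gradient of the bump is of order \<open>2 ^ m / h\<close>, the defect is of smaller order
than the volume.\<close>

lemma bump_flux_zero:
  fixes V :: "'a::euclidean_space \<Rightarrow> 'a"
  assumes V': "\<And>x. (V has_derivative V' x) (at x)"
    and f: "\<And>x. f x = (\<Sum>b\<in>Basis. V' x b \<bullet> b)" "continuous_on UNIV f"
    and "h > 0"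
  shows "bump_flux V f a h = 0"
proof (rule ccontr)
  assume nz: "bump_flux V f a h \<noteq> 0"
  let ?n = "DIM('a)"
  note Vc = continuous_on_has_derivative[OF V', of UNIV]
  define \<epsilon> where "\<epsilon> = \<bar>bump_flux V f a h\<bar> / h ^ ?n"
  have eps: "\<epsilon> > 0" using nz assms by (simp add: \<epsilon>_def)
  define H where "H m = h / 2 ^ m" for m :: nat
  have H: "H m > 0" "H (Suc m) = H m / 2" for m using assms by (auto simp: H_def)
  have "\<exists>A. \<forall>m. \<bar>bump_flux V f (A m) (H m)\<bar> \<ge> \<epsilon> * H m ^ ?n \<and>
      bump_cube (A (Suc m)) (H (Suc m)) \<subseteq> bump_cube (A m) (H m)"
  proof (rule dependent_nat_choice)
    show "\<exists>a. \<epsilon> * H 0 ^ ?n \<le> \<bar>bump_flux V f a (H 0)\<bar>"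
      using assms by (intro exI[of _ a]) (simp add: H_def \<epsilon>_def)
  next
    fix x m assume "\<epsilon> * H m ^ ?n \<le> \<bar>bump_flux V f x (H m)\<bar>"
    from bump_flux_descend[OF Vc f(2) H(1) this]
    show "\<exists>y. \<epsilon> * H (Suc m) ^ ?n \<le> \<bar>bump_flux V f y (H (Suc m))\<bar> \<and>
        bump_cube y (H (Suc m)) \<subseteq> bump_cube x (H m)"
      unfolding H(2) by metis
  qed
  then obtain A where A: "\<And>m. \<bar>bump_flux V f (A m) (H m)\<bar> \<ge> \<epsilon> * H m ^ ?n"
    and sub: "\<And>m. bump_cube (A (Suc m)) (H (Suc m)) \<subseteq> bump_cube (A m) (H m)" by blast
  have "(\<Inter>m. bump_cube (A m) (H m)) \<noteq> {}"
  proof (rule compact_nest)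
    show "compact (bump_cube (A m) (H m))" "bump_cube (A m) (H m) \<noteq> {}" for m
      using H(1)[of m] by (auto simp: bump_cube_def box_ne_empty inner_add_left)
    show "bump_cube (A n) (H n) \<subseteq> bump_cube (A m) (H m)" if "m \<le> n" for m n
      using that sub by (rule lift_Suc_antimono_le[where f = "\<lambda>m. bump_cube (A m) (H m)", rotated])
  qed
  then obtain x0 where x0: "\<And>m. x0 \<in> bump_cube (A m) (H m)" by blast
  \<comment> \<open>The defect on a cube is at most \<open>C\<close> times its scale to the power \<open>n\<close>, times the approximation error.\<close>
  define C where "C = (1 + 3 * real ?n * real ?n) * 3 ^ ?n"
  have Cpos: "C > 0" by (auto simp: C_def intro!: mult_pos_pos add_pos_nonneg)
  define e where "e = \<epsilon> / (2 * C)"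
  have e: "e > 0" using eps Cpos by (simp add: e_def)
  obtain d1 where d1: "d1 > 0" "\<And>y. norm (y - x0) < d1 \<Longrightarrow> norm (V y - V x0 - V' x0 (y - x0)) \<le> e * norm (y - x0)"
    using V'[of x0, unfolded has_derivative_at_alt] e by metis
  obtain d2 where d2: "d2 > 0" "\<And>y. norm (y - x0) < d2 \<Longrightarrow> \<bar>f y - f x0\<bar> < e"
    using f(2)[unfolded continuous_on_iff, rule_format, of x0 e] e by (auto simp: dist_norm)
  have "(\<lambda>m. ?n * (3 * H m)) \<longlonglongrightarrow> 0"
  proof -
    have "(\<lambda>m. real ?n * (3 * (h * (1/2) ^ m))) \<longlonglongrightarrow> real ?n * (3 * (h * 0))"
      by (intro tendsto_intros LIMSEQ_power_zero) auto
    moreover have "h * (1/2) ^ m = H m" for m by (simp add: H_def power_divide)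
    ultimately show ?thesis by simp
  qed
  then have "eventually (\<lambda>m. ?n * (3 * H m) < min d1 d2) sequentially"
    by (rule order_tendstoD) (use d1 d2 in auto)
  then obtain m where m: "?n * (3 * H m) < min d1 d2" by (auto simp: eventually_sequentially)
  define V0 where "V0 x = V x0 + V' x0 (x - x0)" for x
  have lin: "linear (V' x0)" using V' by (rule has_derivative_linear)
  have aff: "bump_flux V0 (\<lambda>_. f x0) (A m) (H m) = 0"
    unfolding V0_def f(1) by (rule bump_flux_affine[OF lin H(1)])
  have V0c: "continuous_on UNIV V0" unfolding V0_def
    by (intro continuous_intros bounded_linear.continuous_on[OF has_derivative_bounded_linear[OF V']])
  have "bump_flux V f (A m) (H m) = bump_flux V f (A m) (H m) - bump_flux V0 (\<lambda>_. f x0) (A m) (H m)"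
    using aff by simp
  also have "\<dots> = (\<integral>x. bump (A m) (H m) x * (f x - f x0) + dbump (A m) (H m) x (V x - V0 x) \<partial>lborel)"
    unfolding bump_flux_def
    by (subst Bochner_Integration.integral_diff[symmetric])
       (intro integrable_bump_flux Vc V0c f H(1) continuous_on_const Bochner_Integration.integral_cong refl
        | simp add: linear_diff[OF linear_dbump] right_diff_distrib)+
  also have "\<bar>\<dots>\<bar> \<le> (\<integral>x. e * (1 + 3 * ?n * ?n) * indicator (bump_cube (A m) (H m)) x \<partial>lborel)"
  proof (rule order_trans[OF integral_abs_bound integral_mono'])
    show "integrable lborel (\<lambda>x. e * (1 + 3 * ?n * ?n) * indicator (bump_cube (A m) (H m)) x :: real)"
      by (rule integrable_const_bump_cube)
    fix x
    show "\<bar>bump (A m) (H m) x * (f x - f x0) + dbump (A m) (H m) x (V x - V0 x)\<bar>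
      \<le> e * (1 + 3 * ?n * ?n) * indicator (bump_cube (A m) (H m)) x"
    proof (cases "x \<in> bump_cube (A m) (H m)")
      case False
      then show ?thesis by (simp add: bump_outside dbump_outside H(1))
    next
      case True
      have nx: "norm (x - x0) \<le> ?n * (3 * H m)" by (rule norm_diff_bump_cube[OF True x0])
      have "\<bar>bump (A m) (H m) x * (f x - f x0)\<bar> \<le> 1 * e"
        unfolding abs_mult using d2(2)[of x] nx m by (intro mult_mono abs_bump_le) auto
      moreover have "\<bar>dbump (A m) (H m) x (V x - V0 x)\<bar> \<le> e * (3 * ?n * ?n)"
      proof -
        have "norm (V x - V0 x) \<le> e * norm (x - x0)"
          using d1(2)[of x] nx m by (simp add: V0_def diff_diff_eq)
        also have "\<dots> \<le> e * (?n * (3 * H m))" using nx e by (intro mult_left_mono) auto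
        finally have "norm (V x - V0 x) \<le> e * (?n * (3 * H m))" .
        then have "?n * norm (V x - V0 x) / H m \<le> ?n * (e * (?n * (3 * H m))) / H m"
          using H(1)[of m] by (intro divide_right_mono mult_left_mono) auto
        also have "\<dots> = e * (3 * ?n * ?n)" using H(1)[of m] by simp
        finally show ?thesis using abs_dbump_le[OF H(1), of "A m" m x "V x - V0 x"] by linarith
      qed
      ultimately show ?thesis using True by (simp add: distrib_left)
    qed
  qed (use e in \<open>auto intro!: mult_nonneg_nonneg\<close>)
  also have "\<dots> = e * C * H m ^ ?n"
    by (simp add: measure_bump_cube[OF H(1)] C_def power_mult_distrib)
  also have "\<dots> = \<epsilon> / 2 * H m ^ ?n" using Cpos by (simp add: e_def)
  also have "\<dots> < \<epsilon> * H m ^ ?n" using eps H(1)[of m] by simp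
  finally show False using A[of m] by simp
qed

text \<open>Bumps of size tending to infinity, centred at the origin, tend to the constant value of the bump at
its centre, while their gradients tend to zero.\<close>

theorem integral_divergence_zero:
  fixes V :: "'a::euclidean_space \<Rightarrow> 'a"
  assumes V': "\<And>x. (V has_derivative V' x) (at x)"
    and f: "\<And>x. f x = (\<Sum>b\<in>Basis. V' x b \<bullet> b)" "continuous_on UNIV f"
    and S: "bounded S" "\<And>x. x \<notin> S \<Longrightarrow> V x = 0"
  shows "integrable lborel f" "(\<integral>x. f x \<partial>lborel) = 0"
proof -
  note Vc = continuous_on_has_derivative[OF V', of UNIV]
  obtain r where r: "r > 0" "\<And>x. x \<in> S \<Longrightarrow> norm x \<le> r" using S(1) by (auto simp: bounded_pos)
  have V0: "V x = 0" if "norm x > r" for x using S(2) r that by force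
  have f0: "f x = 0" if "norm x > r" for x
  proof -
    have "((\<lambda>_. 0::'a) has_derivative (\<lambda>_. 0)) (at x)" by simp
    moreover have "open {x::'a. norm x > r}" by (intro open_Collect_less continuous_intros)
    ultimately have "(V has_derivative (\<lambda>_. 0)) (at x)"
      by (rule has_derivative_transform_within_open) (use that V0 in auto)
    then have "V' x = (\<lambda>_. 0)" using has_derivative_unique[OF V'] by metis
    then show ?thesis by (simp add: f)
  qed
  show int: "integrable lborel f"
    by (rule integrable_continuous_bounded_support[OF f(2) bounded_cball[of 0 r]]) (use f0 in auto)
  have "bounded (V ` cball 0 r)"
    by (rule compact_imp_bounded, rule compact_continuous_image[OF continuous_on_subset[OF Vc]]) auto
  then obtain M where "\<forall>x\<in>cball 0 r. norm (V x) \<le> M"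
    unfolding bounded_iff by auto
  then have M: "norm (V x) \<le> M * indicator (cball 0 r) x" for x
    using V0 by (auto simp: indicator_def)
  have M0: "M \<ge> 0" using M[of 0] r by simp (smt (verit) norm_ge_zero)
  define h where "h m = real (Suc m)" for m
  define a :: "nat \<Rightarrow> 'a" where "a m = - ((3/2 * h m) *\<^sub>R One)" for m
  have h: "h m > 0" "h m \<ge> 1" for m by (auto simp: h_def)
  let ?n = "real DIM('a)"
  have inv: "(\<lambda>m. 1 / h m) \<longlonglongrightarrow> 0"
    using LIMSEQ_inverse_real_of_nat by (simp add: h_def inverse_eq_divide)
  have "(\<lambda>m. bump_flux V f (a m) (h m)) \<longlonglongrightarrow> (\<integral>x. (3/4) ^ DIM('a) * f x \<partial>lborel)"
    unfolding bump_flux_def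
  proof (rule integral_dominated_convergence[where w = "\<lambda>x. \<bar>f x\<bar> + ?n * (M * indicator (cball 0 r) x)"])
    show "integrable lborel (\<lambda>x. \<bar>f x\<bar> + ?n * (M * indicator (cball 0 r) x))"
      using int emeasure_bounded_finite[of "cball 0 r"]
      by (intro integrable_mult_right integrable_real_indicator Bochner_Integration.integrable_add integrable_abs) auto
    show "AE x in lborel. (\<lambda>m. bump (a m) (h m) x * f x + dbump (a m) (h m) x (V x))
        \<longlonglongrightarrow> (3/4) ^ DIM('a) * f x"
    proof (rule AE_I2)
      fix x
      have "(\<lambda>m. bump (a m) (h m) x) \<longlonglongrightarrow> (\<Prod>b\<in>(Basis::'a set). bspline (3/2))"
        unfolding bump_def
      proof (rule tendsto_prod)
        fix b :: 'a assume b: "b \<in> Basis"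
        have "(\<lambda>m. (x \<bullet> b) * (1 / h m) + 3/2) \<longlonglongrightarrow> (x \<bullet> b) * 0 + 3/2"
          by (intro tendsto_intros inv)
        moreover have "(x \<bullet> b) * (1 / h m) + 3/2 = (x \<bullet> b - a m \<bullet> b) / h m" for m
          using h(1)[of m] b by (simp add: a_def field_simps)
        moreover have "isCont bspline (3/2)" by (rule DERIV_isCont[OF has_real_derivative_bspline])
        ultimately show "(\<lambda>m. bspline ((x \<bullet> b - a m \<bullet> b) / h m)) \<longlonglongrightarrow> bspline (3/2)"
          using isCont_tendsto_compose[of "3/2" bspline] by simp
      qed
      moreover have "(\<lambda>m. dbump (a m) (h m) x (V x)) \<longlonglongrightarrow> 0"
      proof (rule tendsto_rabs_zero_cancel, rule tendsto_sandwich[of "\<lambda>_. 0" _ _ "\<lambda>m. ?n * norm (V x) * (1 / h m)"])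
        show "(\<lambda>m. ?n * norm (V x) * (1 / h m)) \<longlonglongrightarrow> 0"
          using tendsto_mult_right_zero[OF inv] by simp
      qed (use abs_dbump_le[OF h(1), of "a _" _ x "V x"] in auto)
      ultimately have "(\<lambda>m. bump (a m) (h m) x * f x + dbump (a m) (h m) x (V x))
          \<longlonglongrightarrow> (\<Prod>b\<in>(Basis::'a set). bspline (3/2)) * f x + 0"
        by (intro tendsto_intros)
      then show "(\<lambda>m. bump (a m) (h m) x * f x + dbump (a m) (h m) x (V x)) \<longlonglongrightarrow> (3/4) ^ DIM('a) * f x"
        by (simp add: bspline_mid)
    qed
    show "AE x in lborel. norm (bump (a m) (h m) x * f x + dbump (a m) (h m) x (V x))
        \<le> \<bar>f x\<bar> + ?n * (M * indicator (cball 0 r) x)" for m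
    proof (rule AE_I2)
      fix x
      have "\<bar>bump (a m) (h m) x * f x\<bar> \<le> 1 * \<bar>f x\<bar>"
        unfolding abs_mult by (intro mult_right_mono abs_bump_le) auto
      moreover have "\<bar>dbump (a m) (h m) x (V x)\<bar> \<le> ?n * (M * indicator (cball 0 r) x)"
      proof -
        have "?n * norm (V x) / h m \<le> ?n * norm (V x) / 1"
          by (rule divide_left_mono) (use h[of m] in auto)
        also have "\<dots> \<le> ?n * (M * indicator (cball 0 r) x)" using M by (simp add: mult_left_mono)
        finally show ?thesis using abs_dbump_le[OF h(1), of "a m" m x "V x"] by linarith
      qed
      ultimately show "norm (bump (a m) (h m) x * f x + dbump (a m) (h m) x (V x))
          \<le> \<bar>f x\<bar> + ?n * (M * indicator (cball 0 r) x)"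
        unfolding real_norm_def by linarith
    qed
  qed (use f(2) Vc h in \<open>auto intro!: borel_measurable_continuous_onI continuous_intros continuous_on_bump
        continuous_on_dbump simp: less_imp_neq[THEN not_sym]\<close>)
  moreover have "bump_flux V f (a m) (h m) = 0" for m
    by (rule bump_flux_zero[OF V' f h(1)])
  ultimately have "(\<integral>x. (3/4) ^ DIM('a) * f x \<partial>lborel) = 0" by (simp add: LIMSEQ_const_iff)
  then show "(\<integral>x. f x \<partial>lborel) = 0" by simp
qed

section \<open>Cutoffs and fields with small flux at infinity\<close>

text \<open>Powers of a truncated paraboloid satisfy \<open>|grad \<eta>| \<le> (C / R) \<eta>^(1 - 1/m)\<close> with \<open>m\<close> the power, which
for \<open>m \<ge> \<gamma>\<close> is exactly what is needed to absorb the boundary term in \<open>cutoff_reaction_le\<close>.\<close>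

definition paraboloid :: "real \<Rightarrow> 'a::euclidean_space \<Rightarrow> real" where
  "paraboloid R x = max 0 (1 - (x \<bullet> x) / R\<^sup>2)"

definition cutoff :: "nat \<Rightarrow> real \<Rightarrow> 'a::euclidean_space \<Rightarrow> real" where
  "cutoff k R x = paraboloid R x ^ Suc (Suc k)"

definition dcutoff :: "nat \<Rightarrow> real \<Rightarrow> 'a::euclidean_space \<Rightarrow> 'a \<Rightarrow> real" where
  "dcutoff k R x v = real (Suc (Suc k)) * paraboloid R x ^ Suc k * (- 2 * (x \<bullet> v) / R\<^sup>2)"

lemma has_derivative_cutoff:
  assumes "R > 0"
  shows "(cutoff k R has_derivative dcutoff k R x) (at x)"
proof -
  have 1: "((\<lambda>x. 1 - (x \<bullet> x) / R\<^sup>2) has_derivative (\<lambda>v. - 2 * (x \<bullet> v) / R\<^sup>2)) (at x)"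
    by (auto intro!: derivative_eq_intros simp: assms less_imp_neq[THEN not_sym] inner_commute field_simps)
  show ?thesis
    unfolding cutoff_def[abs_def] dcutoff_def[abs_def] paraboloid_def
    by (rule has_derivative_eq_rhs[OF has_derivative_compose[OF 1
          has_real_derivative_truncated_power[unfolded has_field_derivative_def]]]) auto
qed

lemma paraboloid_nonneg: "0 \<le> paraboloid R x"
  by (simp add: paraboloid_def)

lemma paraboloid_le_1: "paraboloid R x \<le> 1"
  by (simp add: paraboloid_def)

lemma paraboloid_outside: "R > 0 \<Longrightarrow> R \<le> norm x \<Longrightarrow> paraboloid R x = 0"
  using power_mono[of R "norm x" 2] by (simp add: paraboloid_def power2_norm_eq_inner)

lemma cutoff_outside: "R > 0 \<Longrightarrow> R \<le> norm x \<Longrightarrow> cutoff k R x = 0"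
  by (simp add: cutoff_def paraboloid_outside)

lemma dcutoff_outside: "R > 0 \<Longrightarrow> R \<le> norm x \<Longrightarrow> dcutoff k R x v = 0"
  by (simp add: dcutoff_def paraboloid_outside)

lemma cutoff_nonneg: "0 \<le> cutoff k R x"
  unfolding cutoff_def by (intro zero_le_power paraboloid_nonneg)

lemma cutoff_le_1: "cutoff k R x \<le> 1"
  unfolding cutoff_def by (intro power_le_one paraboloid_nonneg paraboloid_le_1)

lemma cutoff_inner_ball:
  assumes "R > 0" "norm x \<le> R / 2"
  shows "(3/4) ^ Suc (Suc k) \<le> cutoff k R x"
proof -
  have "x \<bullet> x \<le> (R / 2)\<^sup>2"
    using power_mono[OF assms(2), of 2] by (simp add: power2_norm_eq_inner)
  then have "3/4 \<le> 1 - (x \<bullet> x) / R\<^sup>2"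
    using assms(1) by (simp add: field_simps)
  then have "3/4 \<le> paraboloid R x"
    unfolding paraboloid_def by linarith
  then show ?thesis unfolding cutoff_def by (intro power_mono) auto
qed

lemma continuous_on_paraboloid: "R > 0 \<Longrightarrow> continuous_on S (paraboloid R)"
  unfolding paraboloid_def[abs_def] by (intro continuous_intros) auto

lemma continuous_on_cutoff: "R > 0 \<Longrightarrow> continuous_on S (cutoff k R)"
  unfolding cutoff_def[abs_def] by (intro continuous_intros continuous_on_paraboloid)

lemma continuous_on_dcutoff:
  "R > 0 \<Longrightarrow> continuous_on S V \<Longrightarrow> continuous_on S (\<lambda>x. dcutoff k R x (V x))"
  unfolding dcutoff_def by (intro continuous_intros continuous_on_paraboloid) auto

lemma integrable_cutoff:
  assumes "R > 0" "continuous_on UNIV f"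
  shows "integrable lborel (\<lambda>x. cutoff k R x * f x)"
  by (rule integrable_continuous_bounded_support[OF _ bounded_cball[of 0 R]])
     (use assms in \<open>auto intro!: continuous_intros continuous_on_cutoff simp: cutoff_outside\<close>)

lemma integrable_dcutoff:
  assumes "R > 0" "continuous_on UNIV V"
  shows "integrable lborel (\<lambda>x. dcutoff k R x (V x))"
  by (rule integrable_continuous_bounded_support[OF _ bounded_cball[of 0 R]])
     (use assms in \<open>auto intro!: continuous_intros continuous_on_dcutoff simp: dcutoff_outside\<close>)

lemma linear_dcutoff: "R > 0 \<Longrightarrow> linear (dcutoff k R x)"
  using has_derivative_cutoff by (rule has_derivative_linear)

lemma integral_cutoff_divergence:
  fixes V :: "'a::euclidean_space \<Rightarrow> 'a"
  assumes V': "\<And>x. (V has_derivative V' x) (at x)"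
    and D: "\<And>x. D x = (\<Sum>b\<in>Basis. V' x b \<bullet> b)" "continuous_on UNIV D"
    and R: "R > 0"
  shows "(\<integral>x. cutoff k R x * D x \<partial>lborel) = - (\<integral>x. dcutoff k R x (V x) \<partial>lborel)"
proof -
  note Vc = continuous_on_has_derivative[OF V', of UNIV]
  have der: "((\<lambda>x. cutoff k R x *\<^sub>R V x) has_derivative
      (\<lambda>w. cutoff k R x *\<^sub>R V' x w + dcutoff k R x w *\<^sub>R V x)) (at x)" for x
    by (rule has_derivative_scaleR[OF has_derivative_cutoff[OF R] V'])
  have "dcutoff k R x (V x) = (\<Sum>b\<in>Basis. dcutoff k R x b * (V x \<bullet> b))" for x
  proof -
    have "dcutoff k R x (V x) = dcutoff k R x (\<Sum>b\<in>Basis. (V x \<bullet> b) *\<^sub>R b)"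
      by (simp add: euclidean_representation)
    then show ?thesis
      by (simp add: linear_sum[OF linear_dcutoff[OF R]] linear_scale[OF linear_dcutoff[OF R]] mult.commute)
  qed
  then have div: "cutoff k R x * D x + dcutoff k R x (V x) =
      (\<Sum>b\<in>Basis. (cutoff k R x *\<^sub>R V' x b + dcutoff k R x b *\<^sub>R V x) \<bullet> b)" for x
    by (simp add: D(1) inner_add_left sum.distrib sum_distrib_left)
  have "(\<integral>x. cutoff k R x * D x + dcutoff k R x (V x) \<partial>lborel) = 0"
    by (rule integral_divergence_zero(2)[OF der div _ bounded_cball[of 0 R]])
       (use R D(2) Vc in \<open>auto intro!: continuous_intros continuous_on_cutoff continuous_on_dcutoff
          simp: cutoff_outside\<close>)
  then show ?thesis
    using integrable_cutoff[OF R D(2)] integrable_dcutoff[OF R Vc] by simp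
qed

lemma cutoff_tendsto_1: "(\<lambda>j. cutoff k (real (Suc j)) x) \<longlonglongrightarrow> 1"
proof -
  have "(\<lambda>j. max 0 (1 - (x \<bullet> x) * (inverse (real (Suc j)) ^ 2)) ^ Suc (Suc k)) \<longlonglongrightarrow> max 0 (1 - (x \<bullet> x) * 0 ^ 2) ^ Suc (Suc k)"
    by (intro tendsto_intros LIMSEQ_inverse_real_of_nat)
  then show ?thesis
    by (simp add: cutoff_def paraboloid_def divide_inverse power_inverse)
qed

lemma abs_dcutoff_le:
  assumes "R > 0" "\<bar>x \<bullet> v\<bar> \<le> (norm x)\<^sup>2 * c"
  shows "\<bar>dcutoff k R x v\<bar> \<le> 2 * real (Suc (Suc k)) * \<bar>c\<bar>"
proof (cases "norm x < R")
  case False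
  then show ?thesis using assms by (simp add: dcutoff_outside)
next
  case True
  have "\<bar>x \<bullet> v\<bar> \<le> R\<^sup>2 * \<bar>c\<bar>"
  proof -
    have "(norm x)\<^sup>2 * c \<le> R\<^sup>2 * \<bar>c\<bar>"
      using True power_mono[of "norm x" R 2] by (intro order_trans[OF mult_left_mono[of c "\<bar>c\<bar>"] mult_right_mono]) auto
    then show ?thesis using assms(2) by linarith
  qed
  then have "2 * \<bar>x \<bullet> v\<bar> / R\<^sup>2 \<le> 2 * \<bar>c\<bar>" using assms(1) by (simp add: field_simps)
  then have "paraboloid R x ^ Suc k * (2 * \<bar>x \<bullet> v\<bar> / R\<^sup>2) \<le> 1 * (2 * \<bar>c\<bar>)"
    by (intro mult_mono power_le_one paraboloid_nonneg paraboloid_le_1) auto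
  then have "real (Suc (Suc k)) * (paraboloid R x ^ Suc k * (2 * \<bar>x \<bullet> v\<bar> / R\<^sup>2)) \<le> real (Suc (Suc k)) * (2 * \<bar>c\<bar>)"
    by (intro mult_left_mono) auto
  moreover have "\<bar>dcutoff k R x v\<bar> = real (Suc (Suc k)) * (paraboloid R x ^ Suc k * (2 * \<bar>x \<bullet> v\<bar> / R\<^sup>2))"
    unfolding dcutoff_def using paraboloid_nonneg[of R x] by (simp add: abs_mult)
  ultimately show ?thesis by (simp only: mult.assoc mult.left_commute[of 2])
qed

text \<open>On the ball of radius \<open>R\<close> the boundary term is at most a multiple of \<open>|x \<bullet> V| / R\<^sup>2\<close>, which is
dominated by a multiple of \<open>f\<close> and tends to zero pointwise.  Only the radial component of \<open>V\<close> has to be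
bounded, because the gradient of the cutoff is radial.\<close>

lemma cutoff_divergence_tendsto_0:
  fixes V :: "'a::euclidean_space \<Rightarrow> 'a"
  assumes V': "\<And>x. (V has_derivative V' x) (at x)"
    and D: "\<And>x. D x = (\<Sum>b\<in>Basis. V' x b \<bullet> b)" "continuous_on UNIV D"
    and f: "integrable lborel f" "\<And>x. \<bar>x \<bullet> V x\<bar> \<le> (norm x)\<^sup>2 * f x"
  shows "(\<lambda>j. \<integral>x. cutoff k (real (Suc j)) x * D x \<partial>lborel) \<longlonglongrightarrow> 0"
proof -
  note Vc = continuous_on_has_derivative[OF V', of UNIV]
  have "(\<lambda>j. \<integral>x. dcutoff k (real (Suc j)) x (V x) \<partial>lborel) \<longlonglongrightarrow> (\<integral>x. (0::real) \<partial>(lborel::'a measure))"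
  proof (rule integral_dominated_convergence[where w = "\<lambda>x. 2 * real (Suc (Suc k)) * \<bar>f x\<bar>"])
    show "(\<lambda>x. dcutoff k (real (Suc j)) x (V x)) \<in> borel_measurable lborel" for j
      using integrable_dcutoff[OF _ Vc, of "real (Suc j)"] by (auto dest: borel_measurable_integrable)
    show "AE x in lborel. (\<lambda>j. dcutoff k (real (Suc j)) x (V x)) \<longlonglongrightarrow> 0"
    proof (rule AE_I2)
      fix x
      have "\<bar>dcutoff k (real (Suc j)) x (V x)\<bar> \<le> real (Suc (Suc k)) * 2 * \<bar>x \<bullet> V x\<bar> * inverse (real (Suc j)) ^ 2" for j
      proof -
        have "\<bar>dcutoff k (real (Suc j)) x (V x)\<bar> = paraboloid (real (Suc j)) x ^ Suc k *
            (real (Suc (Suc k)) * 2 * \<bar>x \<bullet> V x\<bar> * inverse (real (Suc j)) ^ 2)"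
          unfolding dcutoff_def using paraboloid_nonneg[of "real (Suc j)" x]
          by (simp add: abs_mult field_simps del: of_nat_Suc)
        also have "\<dots> \<le> 1 * (real (Suc (Suc k)) * 2 * \<bar>x \<bullet> V x\<bar> * inverse (real (Suc j)) ^ 2)"
          by (intro mult_right_mono power_le_one paraboloid_nonneg paraboloid_le_1) auto
        finally show ?thesis by simp
      qed
      moreover have "(\<lambda>j. real (Suc (Suc k)) * 2 * \<bar>x \<bullet> V x\<bar> * inverse (real (Suc j)) ^ 2)
          \<longlonglongrightarrow> real (Suc (Suc k)) * 2 * \<bar>x \<bullet> V x\<bar> * 0 ^ 2"
        by (intro tendsto_intros LIMSEQ_inverse_real_of_nat)
      ultimately show "(\<lambda>j. dcutoff k (real (Suc j)) x (V x)) \<longlonglongrightarrow> 0"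
        apply -
        by (rule Lim_null_comparison[where g = "\<lambda>j. real (Suc (Suc k)) * 2 * \<bar>x \<bullet> V x\<bar> * inverse (real (Suc j)) ^ 2"])
           (simp_all del: of_nat_Suc)
    qed
  qed (use f abs_dcutoff_le[OF _ f(2)] in \<open>auto simp del: of_nat_Suc\<close>)
  then show ?thesis
    using integral_cutoff_divergence[OF V' D] tendsto_minus_cancel_left
    by (simp add: tendsto_minus_cancel_left[symmetric] del: of_nat_Suc)
qed

lemma cutoff_integral_tendsto:
  fixes f :: "'a::euclidean_space \<Rightarrow> real"
  assumes "integrable lborel f"
  shows "(\<lambda>j. \<integral>x. cutoff k (real (Suc j)) x * f x \<partial>lborel) \<longlonglongrightarrow> (\<integral>x. f x \<partial>lborel)"
proof (rule integral_dominated_convergence[where w = "\<lambda>x. \<bar>f x\<bar>"])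
  have [measurable]: "f \<in> borel_measurable borel" using assms by auto
  have [measurable]: "cutoff k R \<in> borel_measurable (borel :: 'a measure)" if "R > 0" for R
    by (intro borel_measurable_continuous_onI continuous_on_cutoff that)
  show "(\<lambda>x. cutoff k (real (Suc j)) x * f x) \<in> borel_measurable lborel" for j
    by (intro borel_measurable_times) (simp_all del: of_nat_Suc)
  show "AE x in lborel. (\<lambda>j. cutoff k (real (Suc j)) x * f x) \<longlonglongrightarrow> f x"
    using tendsto_mult_right[OF cutoff_tendsto_1] by (intro AE_I2) force
  show "AE x in lborel. norm (cutoff k (real (Suc j)) x * f x) \<le> \<bar>f x\<bar>" for j
    by (intro AE_I2) (simp add: abs_mult abs_of_nonneg[OF cutoff_nonneg] cutoff_nonneg cutoff_le_1
        mult_left_le_one_le del: of_nat_Suc)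
qed (use assms in auto)

corollary integral_divergence_zero_at_infinity:
  fixes V :: "'a::euclidean_space \<Rightarrow> 'a"
  assumes V': "\<And>x. (V has_derivative V' x) (at x)"
    and D: "\<And>x. D x = (\<Sum>b\<in>Basis. V' x b \<bullet> b)" "continuous_on UNIV D"
    and f: "integrable lborel f" "\<And>x. \<bar>x \<bullet> V x\<bar> \<le> (norm x)\<^sup>2 * f x"
    and int: "integrable lborel D"
  shows "(\<integral>x. D x \<partial>lborel) = 0"
  using LIMSEQ_unique[OF cutoff_integral_tendsto[OF int, of 0] cutoff_divergence_tendsto_0[OF V' D f]] .

section \<open>Symmetry of the second derivative\<close>

text \<open>The mean value theorem, applied along \<open>v\<close> to the increment of \<open>u\<close> along \<open>w\<close>, reduces the second
difference to a difference of two values of \<open>g\<close>, both taken near \<open>x\<close>.  The second difference is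
symmetric in \<open>v\<close> and \<open>w\<close>, and so is therefore the limit.\<close>

lemma second_difference_quotient_tendsto:
  fixes u :: "'a::euclidean_space \<Rightarrow> real"
  assumes u': "\<And>x. (u has_derivative (\<lambda>v. g x \<bullet> v)) (at x)"
    and g': "(g has_derivative H) (at x)"
  shows "((\<lambda>t. (u (x + t *\<^sub>R v + t *\<^sub>R w) - u (x + t *\<^sub>R v) - u (x + t *\<^sub>R w) + u x) / t\<^sup>2)
           \<longlongrightarrow> H w \<bullet> v) (at_right 0)"
proof (rule tendstoI)
  fix e :: real assume e: "e > 0"
  have lin: "linear H" using g' by (rule has_derivative_linear)
  define C where "C = (2 * norm v + norm w) * norm v + 1"
  have C: "C > 0" unfolding C_def by (intro add_nonneg_pos mult_nonneg_nonneg) auto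
  define \<epsilon> where "\<epsilon> = e / C"
  have eps: "\<epsilon> > 0" using e C by (simp add: \<epsilon>_def)
  obtain d where d: "d > 0" "\<And>y. norm (y - x) < d \<Longrightarrow> norm (g y - g x - H (y - x)) \<le> \<epsilon> * norm (y - x)"
    using g'[unfolded has_derivative_at_alt] eps by metis
  define \<delta> where "\<delta> = d / (norm v + norm w + 1)"
  have delta: "\<delta> > 0" using d(1) by (auto simp: \<delta>_def intro!: divide_pos_pos add_nonneg_pos)
  have "dist ((u (x + t *\<^sub>R v + t *\<^sub>R w) - u (x + t *\<^sub>R v) - u (x + t *\<^sub>R w) + u x) / t\<^sup>2) (H w \<bullet> v) < e"
    if t: "0 < t" "t < \<delta>" for t
  proof -
    define \<psi> where "\<psi> s = u (x + s *\<^sub>R v + t *\<^sub>R w) - u (x + s *\<^sub>R v)" for s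
    have D: "(\<psi> has_real_derivative (g (x + s *\<^sub>R v + t *\<^sub>R w) - g (x + s *\<^sub>R v)) \<bullet> v) (at s)" for s
    proof -
      have *: "((\<lambda>s. u (x + s *\<^sub>R v + z)) has_derivative (\<lambda>r. g (x + s *\<^sub>R v + z) \<bullet> (r *\<^sub>R v))) (at s)" for z
        by (rule has_derivative_compose[OF _ u']) (auto intro!: derivative_eq_intros)
      show ?thesis
        unfolding \<psi>_def[abs_def] has_field_derivative_def
        by (rule has_derivative_eq_rhs[OF has_derivative_diff[OF * *[of 0, simplified]]])
           (auto simp: fun_eq_iff algebra_simps)
    qed
    obtain s where s: "0 < s" "s < t"
      "\<psi> t - \<psi> 0 = (t - 0) * ((g (x + s *\<^sub>R v + t *\<^sub>R w) - g (x + s *\<^sub>R v)) \<bullet> v)"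
      using MVT2[OF t(1) D] by auto
    define r where "r y = g (x + y) - g x - H y" for y
    have tn: "t * (norm v + norm w) < d"
    proof -
      have "t * (norm v + norm w) \<le> t * (norm v + norm w + 1)" using t by (intro mult_left_mono) auto
      also have "\<dots> < \<delta> * (norm v + norm w + 1)" using t by (intro mult_strict_right_mono) (auto intro: add_nonneg_pos)
      also have "\<dots> = d" by (simp add: \<delta>_def add_nonneg_eq_0_iff)
      finally show ?thesis .
    qed
    have sv: "norm (s *\<^sub>R v) \<le> t * norm v" using s t by (auto intro: mult_right_mono)
    have n1: "norm (s *\<^sub>R v + t *\<^sub>R w) \<le> t * (norm v + norm w)"
      using norm_triangle_ineq[of "s *\<^sub>R v" "t *\<^sub>R w"] sv t by (simp add: distrib_left)
    have "norm (r (s *\<^sub>R v + t *\<^sub>R w)) \<le> \<epsilon> * norm (s *\<^sub>R v + t *\<^sub>R w)"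
      using d(2)[of "x + (s *\<^sub>R v + t *\<^sub>R w)"] n1 tn by (simp add: r_def)
    also have "\<dots> \<le> \<epsilon> * (t * (norm v + norm w))" using n1 eps by (intro mult_left_mono) auto
    finally have r1: "norm (r (s *\<^sub>R v + t *\<^sub>R w)) \<le> \<epsilon> * (t * (norm v + norm w))" .
    have "t * norm v \<le> t * (norm v + norm w)" using t by (intro mult_left_mono) auto
    then have "norm (r (s *\<^sub>R v)) \<le> \<epsilon> * norm (s *\<^sub>R v)"
      using d(2)[of "x + s *\<^sub>R v"] sv tn by (simp add: r_def)
    also have "\<dots> \<le> \<epsilon> * (t * norm v)" using sv eps by (intro mult_left_mono) auto
    finally have r2: "norm (r (s *\<^sub>R v)) \<le> \<epsilon> * (t * norm v)" .
    have "(u (x + t *\<^sub>R v + t *\<^sub>R w) - u (x + t *\<^sub>R v) - u (x + t *\<^sub>R w) + u x)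
        = t * ((g (x + s *\<^sub>R v + t *\<^sub>R w) - g (x + s *\<^sub>R v)) \<bullet> v)"
      using s(3) by (simp add: \<psi>_def)
    also have "g (x + s *\<^sub>R v + t *\<^sub>R w) - g (x + s *\<^sub>R v)
        = t *\<^sub>R H w + (r (s *\<^sub>R v + t *\<^sub>R w) - r (s *\<^sub>R v))"
      by (simp add: r_def linear_add[OF lin] linear_scale[OF lin] add.assoc)
    finally have eq: "(u (x + t *\<^sub>R v + t *\<^sub>R w) - u (x + t *\<^sub>R v) - u (x + t *\<^sub>R w) + u x) / t\<^sup>2 - H w \<bullet> v
        = ((r (s *\<^sub>R v + t *\<^sub>R w) - r (s *\<^sub>R v)) \<bullet> v) / t"
      using t by (simp add: inner_add_left add_divide_distrib distrib_left power2_eq_square)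
    have "\<bar>(r (s *\<^sub>R v + t *\<^sub>R w) - r (s *\<^sub>R v)) \<bullet> v\<bar> \<le> norm (r (s *\<^sub>R v + t *\<^sub>R w) - r (s *\<^sub>R v)) * norm v"
      by (rule Cauchy_Schwarz_ineq2)
    also have "\<dots> \<le> (\<epsilon> * (t * (norm v + norm w)) + \<epsilon> * (t * norm v)) * norm v"
      by (intro mult_right_mono order_trans[OF norm_triangle_ineq4] add_mono r1 r2) auto
    also have "\<dots> = t * (\<epsilon> * (C - 1))" by (simp add: C_def algebra_simps)
    also have "\<dots> < t * e"
    proof -
      have "\<epsilon> * (C - 1) < \<epsilon> * C" using eps by simp
      also have "\<dots> = e" using C by (simp add: \<epsilon>_def)
      finally show ?thesis using t by simp
    qed
    finally show ?thesis unfolding dist_real_def eq using t by (simp add: field_simps)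
  qed
  then show "\<forall>\<^sub>F t in at_right 0. dist ((u (x + t *\<^sub>R v + t *\<^sub>R w) - u (x + t *\<^sub>R v) - u (x + t *\<^sub>R w) + u x) / t\<^sup>2) (H w \<bullet> v) < e"
    using delta by (auto simp: eventually_at_right[of 0 1] intro!: exI[of _ \<delta>])
qed

lemma second_derivative_symmetric:
  fixes u :: "'a::euclidean_space \<Rightarrow> real"
  assumes u': "\<And>x. (u has_derivative (\<lambda>v. g x \<bullet> v)) (at x)"
    and g': "(g has_derivative H) (at x)"
  shows "H w \<bullet> v = H v \<bullet> w"
proof -
  have "((\<lambda>t. (u (x + t *\<^sub>R v + t *\<^sub>R w) - u (x + t *\<^sub>R v) - u (x + t *\<^sub>R w) + u x) / t\<^sup>2)
           \<longlongrightarrow> H v \<bullet> w) (at_right 0)"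
    using second_difference_quotient_tendsto[OF assms, of w v] by (simp add: algebra_simps)
  then show ?thesis
    using second_difference_quotient_tendsto[OF assms, of v w] by (intro tendsto_unique) auto
qed

section \<open>Averages of powers of a positive solution\<close>

text \<open>Young's inequality in the form that allows the term with \<open>w powr \<gamma>\<close> to be absorbed: either \<open>B\<close> is at
most \<open>(\<gamma> - 1) h w\<close> and the first term on the right is enough, or \<open>w\<close> is at most
\<open>B / ((\<gamma> - 1) h)\<close> and inserting this bound leaves a non-negative power of \<open>h\<close>.\<close>

lemma young_cutoff_inequality:
  fixes h w B \<gamma> :: real
  assumes "0 \<le> h" "h \<le> 1" "0 \<le> w" "0 < B" "1 < \<gamma>" "\<gamma> \<le> real (Suc (Suc k))"
  shows "B * h ^ Suc k * w powr (\<gamma> - 1)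
    \<le> (\<gamma> - 1) * h ^ Suc (Suc k) * w powr \<gamma> + (\<gamma> - 1) powr (1 - \<gamma>) * B powr \<gamma>"
proof (cases "B \<le> (\<gamma> - 1) * h * w")
  case True
  then have "w > 0" using assms by (cases "w = 0") auto
  then have "w powr \<gamma> = w * w powr (\<gamma> - 1)" by (simp add: powr_mult_base)
  moreover have "B * (h ^ Suc k * w powr (\<gamma> - 1)) \<le> (\<gamma> - 1) * h * w * (h ^ Suc k * w powr (\<gamma> - 1))"
    using True assms by (intro mult_right_mono) auto
  moreover have "0 \<le> (\<gamma> - 1) powr (1 - \<gamma>) * B powr \<gamma>" by (intro mult_nonneg_nonneg powr_ge_zero)
  ultimately show ?thesis by (auto simp only: power_Suc ac_simps)
next
  case False
  have n: "0 \<le> (\<gamma> - 1) * h ^ Suc (Suc k) * w powr \<gamma>" using assms by simp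
  show ?thesis
  proof (cases "h = 0")
    case True
    then show ?thesis by simp
  next
    case h0: False
    then have h: "h > 0" using assms by simp
    have "w \<le> B / ((\<gamma> - 1) * h)" using False h assms by (simp add: field_simps)
    then have "w powr (\<gamma> - 1) \<le> (B / ((\<gamma> - 1) * h)) powr (\<gamma> - 1)"
      using assms by (intro powr_mono2) auto
    then have "B * h ^ Suc k * w powr (\<gamma> - 1) \<le> B * h ^ Suc k * (B / ((\<gamma> - 1) * h)) powr (\<gamma> - 1)"
      using assms by (intro mult_left_mono) auto
    also have "\<dots> = (\<gamma> - 1) powr (1 - \<gamma>) * B powr \<gamma> * h powr (real (Suc k) - (\<gamma> - 1))"
    proof -
      have "(B / ((\<gamma> - 1) * h)) powr (\<gamma> - 1) = B powr (\<gamma> - 1) * (\<gamma> - 1) powr (1 - \<gamma>) * h powr - (\<gamma> - 1)"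
        using assms h by (simp add: powr_divide powr_mult powr_minus_divide)
           (simp add: powr_diff field_simps)
      moreover have "B powr \<gamma> = B * B powr (\<gamma> - 1)" using assms by (simp add: powr_mult_base)
      moreover have "h powr (real (Suc k) - (\<gamma> - 1)) = h ^ Suc k * h powr - (\<gamma> - 1)"
        using h by (simp only: diff_conv_add_uminus powr_add powr_realpow)
      ultimately show ?thesis by (simp only: ac_simps)
    qed
    also have "\<dots> \<le> (\<gamma> - 1) powr (1 - \<gamma>) * B powr \<gamma> * 1"
      using assms h by (intro mult_left_mono powr_le1) auto
    finally show ?thesis using n by simp
  qed
qed

lemma nn_integral_scaleR:
  fixes f :: "'a::euclidean_space \<Rightarrow> ennreal"
  assumes [measurable]: "f \<in> borel_measurable borel" and r: "r > 0"
  shows "(\<integral>\<^sup>+y. f (r *\<^sub>R y) \<partial>lborel) = ennreal (1 / r ^ DIM('a)) * (\<integral>\<^sup>+y. f y \<partial>lborel)"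
proof -
  have "(\<integral>\<^sup>+y. f y \<partial>lborel) = ennreal (r ^ DIM('a)) * (\<integral>\<^sup>+y. f (r *\<^sub>R y) \<partial>lborel)"
    using r by (subst lborel_affine[of r 0])
      (auto simp: nn_integral_density nn_integral_distr nn_integral_cmult)
  then show ?thesis
    using r by (simp add: mult.assoc[symmetric] ennreal_mult[symmetric])
qed

text \<open>The equation in coordinate-free form, with the gradient, the flux and the derivative of the flux as
explicit parameters.\<close>

locale gamma_laplace_solution =
  fixes u :: "'a::euclidean_space \<Rightarrow> real" and g F :: "'a \<Rightarrow> 'a" and F' :: "'a \<Rightarrow> 'a \<Rightarrow> 'a"
    and \<gamma> p :: real
  assumes gamma_gt_1: "1 < \<gamma>"
    and pos: "u x > 0"
    and u': "(u has_derivative (\<lambda>v. g x \<bullet> v)) (at x)"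
    and F_eq: "F x = norm (g x) powr (\<gamma> - 2) *\<^sub>R g x"
    and F': "(F has_derivative F' x) (at x)"
    and div_F: "(\<Sum>b\<in>Basis. F' x b \<bullet> b) = - (u x powr p)"
begin

lemma norm_F: "norm (F x) = norm (g x) powr (\<gamma> - 1)"
proof (cases "g x = 0")
  case False
  then show ?thesis using powr_mult_base[of "norm (g x)" "\<gamma> - 2"] by (simp add: F_eq mult.commute)
qed (simp add: F_eq)

lemma inner_g_F: "g x \<bullet> F x = norm (g x) powr \<gamma>"
proof (cases "g x = 0")
  case False
  then have "norm (g x) powr \<gamma> = norm (g x) powr (\<gamma> - 2) * (norm (g x) * norm (g x))"
    using powr_add[of "norm (g x)" "\<gamma> - 2" 2] by (simp add: power2_eq_square)
  then show ?thesis by (simp add: F_eq power2_norm_eq_inner[symmetric] power2_eq_square)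
qed (simp add: F_eq)

text \<open>The inverse of the map that sends a gradient to its flux.  It is continuous, and differentiable away
from the origin, and transfers this regularity from \<open>F\<close> to \<open>g\<close>.\<close>

definition G :: "'a \<Rightarrow> 'a" where
  "G v = norm v powr ((2 - \<gamma>) / (\<gamma> - 1)) *\<^sub>R v"

lemma norm_G: "norm (G v) = norm v powr (1 / (\<gamma> - 1))"
proof (cases "v = 0")
  case False
  have "(2 - \<gamma>) / (\<gamma> - 1) + 1 = 1 / (\<gamma> - 1)" using gamma_gt_1 by (simp add: field_simps)
  then show ?thesis using False powr_mult_base[of "norm v" "(2 - \<gamma>) / (\<gamma> - 1)"]
    by (simp add: G_def mult.commute add.commute)
qed (simp add: G_def)

lemma g_eq: "g x = G (F x)"
proof (cases "g x = 0")
  case False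
  have "norm (F x) powr ((2 - \<gamma>) / (\<gamma> - 1)) = norm (g x) powr (2 - \<gamma>)"
    using gamma_gt_1 by (simp add: norm_F powr_powr)
  moreover have "norm (g x) powr (2 - \<gamma>) * norm (g x) powr (\<gamma> - 2) = 1"
    using False by (simp add: powr_add[symmetric])
  ultimately show ?thesis by (simp add: G_def) (simp add: F_eq)
qed (simp add: G_def F_eq)

lemma isCont_G: "isCont G v"
proof (cases "v = 0")
  case True
  have "((\<lambda>v::'a. norm v powr (1 / (\<gamma> - 1))) \<longlongrightarrow> 0) (at 0)"
    using gamma_gt_1 by (intro tendsto_eq_intros tendsto_powr2[where a = 0, THEN tendsto_eq_rhs] | simp)+
  then have "(G \<longlongrightarrow> 0) (at 0)"
    by (rule tendsto_norm_zero_cancel[of G, unfolded norm_G])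
  then show ?thesis using True by (simp add: isCont_def G_def)
next
  case False
  then show ?thesis unfolding G_def[abs_def] by (intro continuous_intros) auto
qed

lemma continuous_on_u: "continuous_on S u"
  using u' by (rule continuous_on_has_derivative)

lemma continuous_on_F: "continuous_on S F"
  using F' by (rule continuous_on_has_derivative)

lemma continuous_on_g: "continuous_on S g"
  unfolding g_eq[abs_def]
  by (rule continuous_on_compose2[OF _ continuous_on_F, of UNIV G])
     (auto intro: continuous_at_imp_continuous_on isCont_G)

lemma continuous_on_u_powr: "continuous_on S (\<lambda>x. u x powr a)"
  using pos by (intro continuous_intros continuous_on_u) (metis less_irrefl)

lemma continuous_on_g_powr:
  assumes "a > 0"
  shows "continuous_on S (\<lambda>x. norm (g x) powr a)"
  by (rule continuous_on_powr') (use assms in \<open>auto intro!: continuous_intros continuous_on_g\<close>)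

lemma has_derivative_u_powr:
  "((\<lambda>x. u x powr a) has_derivative (\<lambda>v. a * u x powr (a - 1) * (g x \<bullet> v))) (at x)"
proof -
  have "((\<lambda>s. s powr a) has_real_derivative a * u x powr (a - 1)) (at (u x))"
    by (rule has_real_derivative_powr) (rule pos)
  then show ?thesis
    using has_derivative_compose[OF u'] by (simp add: has_field_derivative_def)
qed

text \<open>The divergence theorem for \<open>u^(1-\<gamma>) F\<close>, whose divergence is
\<open>- u^(p+1-\<gamma>) - (\<gamma> - 1) (|g| / u)^\<gamma>\<close>: both terms have the same sign, and the second one
absorbs the boundary term.\<close>

lemma cutoff_reaction_le:
  assumes k: "\<gamma> \<le> real (Suc (Suc k))" and R: "R > 0"
  shows "(\<integral>x. cutoff k R x * u x powr (p + 1 - \<gamma>) \<partial>lborel)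
    \<le> (\<gamma> - 1) powr (1 - \<gamma>) * (2 * real (Suc (Suc k)) / R) powr \<gamma> * measure lborel (ball (0::'a) R)"
proof -
  let ?m = "real (Suc (Suc k))"
  let ?q = "p + 1 - \<gamma>"
  define B where "B = 2 * ?m / R"
  have B: "B > 0" using R by (simp add: B_def)
  define V where "V x = u x powr (1 - \<gamma>) *\<^sub>R F x" for x
  define V' where "V' x w = u x powr (1 - \<gamma>) *\<^sub>R F' x w + ((1 - \<gamma>) * u x powr (1 - \<gamma> - 1) * (g x \<bullet> w)) *\<^sub>R F x" for x w
  have V': "(V has_derivative V' x) (at x)" for x
    unfolding V_def[abs_def] V'_def[abs_def]
    by (rule has_derivative_scaleR[OF has_derivative_u_powr F'])
  define D where "D x = - (u x powr ?q) - (\<gamma> - 1) * (u x powr - \<gamma> * norm (g x) powr \<gamma>)" for x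
  have D: "D x = (\<Sum>b\<in>Basis. V' x b \<bullet> b)" for x
  proof -
    have "(\<Sum>b\<in>Basis. V' x b \<bullet> b) = u x powr (1 - \<gamma>) * (\<Sum>b\<in>Basis. F' x b \<bullet> b)
        + (1 - \<gamma>) * u x powr (1 - \<gamma> - 1) * (\<Sum>b\<in>Basis. (g x \<bullet> b) * (F x \<bullet> b))"
      by (simp add: V'_def inner_add_left sum.distrib sum_distrib_left mult.assoc)
    also have "(\<Sum>b\<in>Basis. (g x \<bullet> b) * (F x \<bullet> b)) = norm (g x) powr \<gamma>"
      by (simp add: euclidean_inner[symmetric] inner_g_F)
    also have "u x powr (1 - \<gamma>) * (\<Sum>b\<in>Basis. F' x b \<bullet> b) = - (u x powr ?q)"
      by (simp add: div_F powr_add[symmetric] algebra_simps)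
    finally show ?thesis by (simp add: D_def algebra_simps)
  qed
  have Dc: "continuous_on UNIV D" unfolding D_def
    by (intro continuous_intros continuous_on_u_powr continuous_on_g_powr) (use gamma_gt_1 in auto)
  note Vc = continuous_on_has_derivative[OF V', of UNIV]
  let ?w = "\<lambda>x. u x powr - \<gamma> * norm (g x) powr \<gamma>"
  have wc: "continuous_on UNIV (\<lambda>x. (\<gamma> - 1) * ?w x)"
    by (intro continuous_intros continuous_on_u_powr continuous_on_g_powr) (use gamma_gt_1 in auto)
  have "(\<integral>x. cutoff k R x * u x powr ?q \<partial>lborel)
      = (\<integral>x. - (cutoff k R x * D x) - cutoff k R x * ((\<gamma> - 1) * ?w x) \<partial>lborel)"
    by (simp add: D_def algebra_simps)
  also have "\<dots> = (\<integral>x. dcutoff k R x (V x) - cutoff k R x * ((\<gamma> - 1) * ?w x) \<partial>lborel)"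
    using integral_cutoff_divergence[OF V' D Dc R, of k] integrable_cutoff[OF R Dc, of k]
      integrable_cutoff[OF R wc, of k] integrable_dcutoff[OF R Vc, of k] by simp
  also have "\<dots> \<le> (\<integral>x. (\<gamma> - 1) powr (1 - \<gamma>) * B powr \<gamma> * indicator (ball (0::'a) R) x \<partial>lborel)"
  proof (rule integral_mono)
    show "integrable lborel (\<lambda>x. dcutoff k R x (V x) - cutoff k R x * ((\<gamma> - 1) * ?w x))"
      by (intro Bochner_Integration.integrable_diff integrable_cutoff[OF R wc] integrable_dcutoff[OF R Vc])
    show "integrable lborel (\<lambda>x. (\<gamma> - 1) powr (1 - \<gamma>) * B powr \<gamma> * indicator (ball (0::'a) R) x)"
      using emeasure_lborel_ball_finite[of "0::'a" R]
      by (intro integrable_mult_right integrable_real_indicator) auto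
    fix x
    show "dcutoff k R x (V x) - cutoff k R x * ((\<gamma> - 1) * ?w x)
      \<le> (\<gamma> - 1) powr (1 - \<gamma>) * B powr \<gamma> * indicator (ball (0::'a) R) x"
    proof (cases "norm x < R")
      case False
      then show ?thesis using R by (simp add: cutoff_outside dcutoff_outside)
    next
      case True
      define w where "w = norm (g x) / u x"
      have w: "w \<ge> 0" using pos[of x] by (simp add: w_def)
      have nV: "norm (V x) = w powr (\<gamma> - 1)"
        using pos[of x] gamma_gt_1 by (simp add: V_def norm_F w_def powr_divide powr_diff field_simps)
      have wg: "?w x = w powr \<gamma>"
        using pos[of x] gamma_gt_1 by (simp add: w_def powr_divide powr_minus_divide)
      have "\<bar>x \<bullet> V x\<bar> \<le> R * w powr (\<gamma> - 1)"
        using Cauchy_Schwarz_ineq2[of x "V x"] True unfolding nV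
        by (elim order_trans) (auto intro: mult_right_mono)
      then have "2 * \<bar>x \<bullet> V x\<bar> / R\<^sup>2 \<le> 2 / R * w powr (\<gamma> - 1)"
        using R by (simp add: field_simps power2_eq_square)
      then have "?m * paraboloid R x ^ Suc k * (2 * \<bar>x \<bullet> V x\<bar> / R\<^sup>2)
          \<le> ?m * paraboloid R x ^ Suc k * (2 / R * w powr (\<gamma> - 1))"
        by (intro mult_left_mono) (auto simp: paraboloid_nonneg)
      moreover have "dcutoff k R x (V x) \<le> ?m * paraboloid R x ^ Suc k * (2 * \<bar>x \<bullet> V x\<bar> / R\<^sup>2)"
        unfolding dcutoff_def using R by (intro mult_left_mono divide_right_mono) (auto simp: paraboloid_nonneg)
      ultimately have "dcutoff k R x (V x) \<le> B * paraboloid R x ^ Suc k * w powr (\<gamma> - 1)"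
        by (simp add: B_def mult_ac del: of_nat_Suc)
      also have "\<dots> \<le> (\<gamma> - 1) * paraboloid R x ^ Suc (Suc k) * w powr \<gamma> + (\<gamma> - 1) powr (1 - \<gamma>) * B powr \<gamma>"
        by (rule young_cutoff_inequality[OF paraboloid_nonneg paraboloid_le_1 w B gamma_gt_1 k])
      finally show ?thesis using True unfolding wg by (simp add: cutoff_def mult_ac)
    qed
  qed
  also have "\<dots> = (\<gamma> - 1) powr (1 - \<gamma>) * B powr \<gamma> * measure lborel (ball (0::'a) R)" by simp
  finally show ?thesis by (simp add: B_def)
qed

lemma rescaled_reaction_le:
  fixes L :: real
  assumes "L > 0"
  shows "\<exists>C\<ge>0. \<forall>r>0. (\<integral>\<^sup>+y. indicator (ball 0 L) y * ennreal (u (r *\<^sub>R y) powr (p + 1 - \<gamma>)) \<partial>lborel)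
      \<le> ennreal (C * r powr - \<gamma>)"
proof -
  obtain k where k: "\<gamma> \<le> real (Suc (Suc k))"
    by (metis real_arch_simple order_trans of_nat_mono le_SucI order_refl)
  let ?q = "p + 1 - \<gamma>" and ?n = "DIM('a)" and ?m = "Suc (Suc k)"
  define C where "C = (4/3) ^ ?m * ((\<gamma> - 1) powr (1 - \<gamma>) * (2 * real ?m) powr \<gamma> * measure lborel (ball (0::'a) 1)
     * (2 * L) ^ ?n * (2 * L) powr - \<gamma>)"
  have "(\<integral>\<^sup>+y. indicator (ball 0 L) y * ennreal (u (r *\<^sub>R y) powr ?q) \<partial>lborel) \<le> ennreal (C * r powr - \<gamma>)"
    if r: "r > 0" for r
  proof -
    define R where "R = 2 * L * r"
    have R: "R > 0" using assms r by (simp add: R_def)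
    let ?f = "\<lambda>x. ennreal ((4/3) ^ ?m * (cutoff k R x * u x powr ?q))"
    have fc: "continuous_on UNIV (\<lambda>x. cutoff k R x * u x powr ?q)"
      by (intro continuous_intros continuous_on_cutoff R continuous_on_u_powr)
    have fm: "?f \<in> borel_measurable borel"
      by (intro measurable_compose[OF _ measurable_ennreal] borel_measurable_times borel_measurable_const
          borel_measurable_continuous_onI fc)
    have "(\<integral>\<^sup>+y. indicator (ball 0 L) y * ennreal (u (r *\<^sub>R y) powr ?q) \<partial>lborel) \<le> (\<integral>\<^sup>+y. ?f (r *\<^sub>R y) \<partial>lborel)"
    proof (rule nn_integral_mono)
      fix y :: 'a
      show "indicator (ball 0 L) y * ennreal (u (r *\<^sub>R y) powr ?q) \<le> ?f (r *\<^sub>R y)"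
      proof (cases "norm y < L")
        case True
        then have "norm (r *\<^sub>R y) \<le> R / 2" using r by (simp add: R_def)
        from cutoff_inner_ball[OF R this, of k]
        have "(4/3) ^ ?m * (3/4) ^ ?m \<le> (4/3) ^ ?m * cutoff k R (r *\<^sub>R y)"
          by (intro mult_left_mono) auto
        then have "1 \<le> (4/3) ^ ?m * cutoff k R (r *\<^sub>R y)"
          unfolding power_mult_distrib[symmetric] by simp
        then have "1 * u (r *\<^sub>R y) powr ?q \<le> ((4/3) ^ ?m * cutoff k R (r *\<^sub>R y)) * u (r *\<^sub>R y) powr ?q"
          by (rule mult_right_mono) simp
        then show ?thesis using True by (simp add: mult.assoc ennreal_leI del: power_Suc)
      qed simp
    qed
    also have "\<dots> = ennreal (1 / r ^ ?n) * (\<integral>\<^sup>+y. ?f y \<partial>lborel)"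
      by (rule nn_integral_scaleR[OF fm r])
    also have "(\<integral>\<^sup>+y. ?f y \<partial>lborel) = ennreal (\<integral>y. (4/3) ^ ?m * (cutoff k R y * u y powr ?q) \<partial>lborel)"
      by (intro nn_integral_eq_integral integrable_mult_right integrable_cutoff[OF R] continuous_on_u_powr)
         (simp add: cutoff_nonneg)
    also have "ennreal (1 / r ^ ?n) * \<dots> = ennreal (1 / r ^ ?n * ((4/3) ^ ?m * (\<integral>y. cutoff k R y * u y powr ?q \<partial>lborel)))"
      using r by (subst ennreal_mult[symmetric])
        (auto intro!: mult_nonneg_nonneg integral_nonneg_AE simp: cutoff_nonneg simp del: power_Suc)
    also have "\<dots> \<le> ennreal (1 / r ^ ?n * ((4/3) ^ ?m * ((\<gamma> - 1) powr (1 - \<gamma>) * (2 * real ?m / R) powr \<gamma> * measure lborel (ball (0::'a) R))))"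
      using r by (intro ennreal_leI mult_left_mono cutoff_reaction_le[OF k R]) auto
    also have "1 / r ^ ?n * ((4/3) ^ ?m * ((\<gamma> - 1) powr (1 - \<gamma>) * (2 * real ?m / R) powr \<gamma> * measure lborel (ball (0::'a) R)))
        = C * r powr - \<gamma>"
    proof -
      have "(2 * real ?m / R) powr \<gamma> = (2 * real ?m) powr \<gamma> * ((2 * L) powr - \<gamma> * r powr - \<gamma>)"
        unfolding R_def using assms r by (simp add: powr_divide powr_mult powr_minus_divide del: of_nat_Suc)
      moreover have "measure lborel (ball (0::'a) R) = (2 * L) ^ ?n * r ^ ?n * measure lborel (ball (0::'a) 1)"
        using content_ball_conv_unit_ball[of R "0::'a"] R by (simp add: R_def power_mult_distrib)
      ultimately show ?thesis using r by (simp add: C_def del: of_nat_Suc power_Suc)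
    qed
    finally show ?thesis .
  qed
  moreover have "C \<ge> 0" unfolding C_def by (intro mult_nonneg_nonneg) (use assms in auto)
  ultimately show ?thesis by blast
qed

text \<open>The bounds of \<open>rescaled_reaction_le\<close> for \<open>r = 2 ^ j\<close> form a convergent geometric series, so
the series of the functions converges almost everywhere on each ball.\<close>

lemma AE_reaction_tendsto_0:
  "AE y in lborel. (\<lambda>j. u (2 ^ j *\<^sub>R y) powr (p + 1 - \<gamma>)) \<longlonglongrightarrow> 0"
proof -
  let ?q = "p + 1 - \<gamma>"
  have meas: "(\<lambda>y. ennreal (u (r *\<^sub>R y) powr ?q)) \<in> borel_measurable borel" for r
    by (intro measurable_compose[OF _ measurable_ennreal] borel_measurable_continuous_onI
        continuous_on_compose2[OF continuous_on_u_powr[of UNIV]]) (auto intro!: continuous_intros)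
  have "AE y in lborel. norm y < real (Suc L) \<longrightarrow> (\<lambda>j. u (2 ^ j *\<^sub>R y) powr ?q) \<longlonglongrightarrow> 0" for L
  proof -
    let ?B = "ball (0::'a) (real (Suc L))"
    obtain C where C: "C \<ge> 0" "\<And>r. r > 0 \<Longrightarrow> (\<integral>\<^sup>+y. indicator ?B y * ennreal (u (r *\<^sub>R y) powr ?q) \<partial>lborel)
      \<le> ennreal (C * r powr - \<gamma>)" using rescaled_reaction_le[of "real (Suc L)"] by auto
    let ?s = "\<lambda>y. \<Sum>j. indicator ?B y * ennreal (u (2 ^ j *\<^sub>R y) powr ?q)"
    have m: "(\<lambda>y. indicator ?B y * ennreal (u (2 ^ j *\<^sub>R y) powr ?q)) \<in> borel_measurable lborel" for j
      using meas by (intro borel_measurable_times_ennreal borel_measurable_indicator) auto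
    have "(\<integral>\<^sup>+y. ?s y \<partial>lborel) = (\<Sum>j. \<integral>\<^sup>+y. indicator ?B y * ennreal (u (2 ^ j *\<^sub>R y) powr ?q) \<partial>lborel)"
      using m by (rule nn_integral_suminf)
    also have "\<dots> \<le> (\<Sum>j. ennreal (C * (2 powr - \<gamma>) ^ j))"
    proof (rule suminf_le)
      fix j
      have "(2 ^ j) powr - \<gamma> = (2 powr - \<gamma>) ^ j"
        by (simp add: powr_powr powr_realpow[symmetric] mult.commute)
      then show "(\<integral>\<^sup>+y. indicator ?B y * ennreal (u (2 ^ j *\<^sub>R y) powr ?q) \<partial>lborel) \<le> ennreal (C * (2 powr - \<gamma>) ^ j)"
        using C(2)[of "2 ^ j"] by simp
    qed auto
    also have "\<dots> < top"
    proof -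
      have "2 powr - \<gamma> < (1::real)" using gamma_gt_1 by (simp add: powr_less_one)
      then have "summable (\<lambda>j. C * (2 powr - \<gamma>) ^ j)" by (intro summable_mult summable_geometric) simp
      then show ?thesis using C(1) by (simp add: ennreal_suminf_neq_top less_top)
    qed
    finally have "AE y in lborel. ?s y \<noteq> \<infinity>"
      by (intro nn_integral_PInf_AE borel_measurable_suminf_order m) (simp only: infinity_ennreal_def less_top)
    then show ?thesis
    proof eventually_elim
      case (elim y)
      show ?case
      proof
        assume "norm y < real (Suc L)"
        then have "(\<Sum>j. ennreal (u (2 ^ j *\<^sub>R y) powr ?q)) \<noteq> \<infinity>" using elim by simp
        then have "summable (\<lambda>j. u (2 ^ j *\<^sub>R y) powr ?q)"
          by (intro summable_suminf_not_top) auto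
        then show "(\<lambda>j. u (2 ^ j *\<^sub>R y) powr ?q) \<longlonglongrightarrow> 0" by (rule summable_LIMSEQ_zero)
      qed
    qed
  qed
  then have "AE y in lborel. \<forall>L. norm y < real (Suc L) \<longrightarrow> (\<lambda>j. u (2 ^ j *\<^sub>R y) powr ?q) \<longlonglongrightarrow> 0"
    by (simp only: AE_all_countable) blast
  then show ?thesis
  proof eventually_elim
    case (elim y)
    obtain L where "norm y < real L" using reals_Archimedean2 by blast
    then have "norm y < real (Suc L)" by simp
    then show ?case using elim by blast
  qed
qed

end

section \<open>Hardy inequality along rays\<close>

lemma nn_integral_powr_tail:
  assumes "a > 1"
  shows "(\<integral>\<^sup>+t. ennreal (t powr - a) * indicator {1..} t \<partial>lborel) = ennreal (1 / (a - 1))"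
proof -
  have "(\<integral>\<^sup>+t. ennreal (t powr - a) * indicator {1..} t \<partial>lborel) = 0 - 1 powr (1 - a) / (1 - a)"
  proof (rule nn_integral_FTC_atLeast[where F = "\<lambda>t. t powr (1 - a) / (1 - a)"])
    show "((\<lambda>t. t powr (1 - a) / (1 - a)) has_real_derivative x powr - a) (at x)" if "1 \<le> x" for x
    proof -
      have "((\<lambda>t. t powr (1 - a)) has_real_derivative (1 - a) * x powr (1 - a - 1)) (at x)"
        by (rule has_real_derivative_powr) (use that in simp)
      from DERIV_cdivide[OF this, of "1 - a"] show ?thesis using assms by simp
    qed
    show "((\<lambda>t. t powr (1 - a) / (1 - a)) \<longlongrightarrow> 0) at_top"
      using assms by (intro tendsto_divide_zero tendsto_neg_powr filterlim_ident) auto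
  qed auto
  also have "0 - 1 powr (1 - a) / (1 - a) = 1 / (a - 1)" using assms by (simp add: field_simps)
  finally show ?thesis .
qed

text \<open>A scaled form of Young's inequality that, after integration along a ray and the right choice of
\<open>\<sigma>\<close>, replaces the inequality of Hoelder.\<close>

lemma weighted_young_inequality:
  fixes w \<sigma> t e \<gamma> :: real
  assumes "0 \<le> w" "0 < \<sigma>" "0 < t" "1 < \<gamma>"
  shows "w \<le> \<sigma> * (t powr - (e / (\<gamma> - 1)) + \<sigma> powr - \<gamma> * (t powr e * w powr \<gamma>))"
proof -
  define \<tau> where "\<tau> = t powr (e / (\<gamma> - 1))"
  define v where "v = w / \<sigma>"
  have tau: "\<tau> > 0" "\<tau> powr (\<gamma> - 1) = t powr e"
    using assms by (auto simp: \<tau>_def powr_powr)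
  have v: "v \<ge> 0" using assms by (simp add: v_def)
  have "v \<le> 1 / \<tau> + t powr e * v powr \<gamma>"
  proof (cases "v * \<tau> \<le> 1")
    case True
    then have "v \<le> 1 / \<tau>" using tau by (simp add: field_simps)
    then show ?thesis by (smt (verit) mult_nonneg_nonneg powr_ge_zero)
  next
    case False
    then have v0: "v > 0" using v by (cases "v = 0") auto
    have "1 \<le> (v * \<tau>) powr (\<gamma> - 1)" using False assms by (intro ge_one_powr_ge_zero) auto
    also have "\<dots> = v powr (\<gamma> - 1) * t powr e" using v tau by (simp add: powr_mult)
    finally have "v * 1 \<le> v * (v powr (\<gamma> - 1) * t powr e)" using v by (intro mult_left_mono)
    also have "\<dots> = t powr e * v powr \<gamma>" using v0 powr_mult_base[of v "\<gamma> - 1"] by (simp add: mult_ac)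
    finally show ?thesis using tau(1) by (simp add: add_increasing)
  qed
  then have "\<sigma> * v \<le> \<sigma> * (1 / \<tau> + t powr e * v powr \<gamma>)" using assms by (intro mult_left_mono) auto
  moreover have "\<sigma> * v = w" using assms by (simp add: v_def)
  moreover have "1 / \<tau> = t powr - (e / (\<gamma> - 1))" by (simp add: \<tau>_def powr_minus_divide)
  moreover have "v powr \<gamma> = \<sigma> powr - \<gamma> * w powr \<gamma>"
    using assms by (simp add: v_def powr_divide powr_minus_divide)
  ultimately show ?thesis by (simp add: mult_ac)
qed

context gamma_laplace_solution
begin

definition ray_energy :: "real \<Rightarrow> 'a \<Rightarrow> ennreal" where
  "ray_energy e y = (\<integral>\<^sup>+t. ennreal (t powr e * norm (g (t *\<^sub>R y)) powr \<gamma>) * indicator {1..} t \<partial>lborel)"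

lemma measurable_g [measurable]: "g \<in> borel_measurable borel"
  by (intro borel_measurable_continuous_onI continuous_on_g)

lemma measurable_u [measurable]: "u \<in> borel_measurable borel"
  by (intro borel_measurable_continuous_onI continuous_on_u)

lemma measurable_ray_energy [measurable]: "ray_energy e \<in> borel_measurable borel"
  unfolding ray_energy_def[abs_def] by measurable

text \<open>By Tonelli's theorem and scaling, the energy on the dilated space contributes the factor \<open>t^(e-n)\<close>,
which is integrable for \<open>e < n - 1\<close>.\<close>

lemma nn_integral_ray_energy:
  assumes "e < real DIM('a) - 1"
  shows "(\<integral>\<^sup>+y. ray_energy e y \<partial>lborel)
    = ennreal (1 / (real DIM('a) - e - 1)) * (\<integral>\<^sup>+x. ennreal (norm (g x) powr \<gamma>) \<partial>lborel)"
proof -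
  let ?n = "DIM('a)"
  let ?E = "\<integral>\<^sup>+x. ennreal (norm (g x) powr \<gamma>) \<partial>lborel"
  have "(\<integral>\<^sup>+y. ray_energy e y \<partial>lborel)
    = (\<integral>\<^sup>+t. (\<integral>\<^sup>+y. ennreal (t powr e * norm (g (t *\<^sub>R y)) powr \<gamma>) * indicator {1..} t \<partial>lborel) \<partial>lborel)"
    unfolding ray_energy_def by (rule lborel_pair.Fubini') measurable
  also have "\<dots> = (\<integral>\<^sup>+t. ?E * (ennreal (t powr - (real ?n - e)) * indicator {1..} t) \<partial>lborel)"
  proof (rule nn_integral_cong)
    fix t :: real
    show "(\<integral>\<^sup>+y. ennreal (t powr e * norm (g (t *\<^sub>R y)) powr \<gamma>) * indicator {1..} t \<partial>lborel)
      = ?E * (ennreal (t powr - (real ?n - e)) * indicator {1..} t)"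
    proof (cases "1 \<le> t")
      case True
      have "(\<integral>\<^sup>+y. ennreal (t powr e * norm (g (t *\<^sub>R y)) powr \<gamma>) \<partial>lborel)
          = ennreal (t powr e) * (\<integral>\<^sup>+y. ennreal (norm (g (t *\<^sub>R y)) powr \<gamma>) \<partial>lborel)"
        by (simp add: ennreal_mult nn_integral_cmult)
      also have "(\<integral>\<^sup>+y. ennreal (norm (g (t *\<^sub>R y)) powr \<gamma>) \<partial>lborel) = ennreal (1 / t ^ ?n) * ?E"
        using True by (intro nn_integral_scaleR) auto
      also have "ennreal (t powr e) * (ennreal (1 / t ^ ?n) * ?E) = ?E * ennreal (t powr - (real ?n - e))"
      proof -
        have "t powr e * (1 / t ^ ?n) = t powr - (real ?n - e)"
          using True by (simp add: powr_diff powr_realpow)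
        then show ?thesis using True by (simp add: mult.assoc[symmetric] ennreal_mult[symmetric] mult.commute)
      qed
      finally show ?thesis using True by simp
    qed simp
  qed
  also have "\<dots> = ?E * (\<integral>\<^sup>+t. ennreal (t powr - (real ?n - e)) * indicator {1..} t \<partial>lborel)"
    by (intro nn_integral_cmult) measurable
  also have "\<dots> = ?E * ennreal (1 / (real ?n - e - 1))"
    using assms by (subst nn_integral_powr_tail) auto
  finally show ?thesis by (simp add: mult.commute)
qed

text \<open>The fundamental theorem of calculus on the ray, combined with the weighted Young inequality; the
weight \<open>t^(-e/(\<gamma>-1))\<close> is integrable at infinity because \<open>e > \<gamma> - 1\<close>.\<close>

lemma ray_oscillation_le:
  assumes lam: "\<sigma> > 0" and T: "T \<ge> 1" and e: "\<gamma> - 1 < e" and m: "ray_energy e y = ennreal m" "m \<ge> 0"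
  shows "\<bar>u (T *\<^sub>R y) - u y\<bar> \<le> norm y * \<sigma> * (1 / (e / (\<gamma> - 1) - 1) + \<sigma> powr - \<gamma> * m)"
proof -
  let ?h = "\<lambda>t. u (t *\<^sub>R y)" and ?h' = "\<lambda>t. g (t *\<^sub>R y) \<bullet> y"
  have a: "e / (\<gamma> - 1) > 1" using e gamma_gt_1 by simp
  have D: "(?h has_real_derivative ?h' t) (at t)" for t
  proof -
    have "(?h has_derivative (\<lambda>s. g (t *\<^sub>R y) \<bullet> (s *\<^sub>R y))) (at t)"
      by (rule has_derivative_compose[OF _ u']) (auto intro!: derivative_eq_intros)
    then show ?thesis unfolding has_field_derivative_def
      by (rule has_derivative_eq_rhs) (auto simp: mult.commute)
  qed
  have cont: "continuous_on UNIV ?h'"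
    by (intro continuous_intros continuous_on_compose2[OF continuous_on_g[of UNIV]]) auto
  then have cont': "isCont ?h' t" for t by (simp add: continuous_on_eq_continuous_at)
  have hb: "has_bochner_integral lborel (\<lambda>t. ?h' t * indicator {1..T} t) (?h T - ?h 1)"
    by (rule has_bochner_integral_FTC_Icc_real[OF T D cont'])
  then have int: "integrable lborel (\<lambda>t. ?h' t * indicator {1..T} t)"
    and eq: "(\<integral>t. ?h' t * indicator {1..T} t \<partial>lborel) = u (T *\<^sub>R y) - u y"
    by (auto simp: has_bochner_integral_iff)
  have "ennreal \<bar>u (T *\<^sub>R y) - u y\<bar> \<le> ennreal (\<integral>t. \<bar>?h' t * indicator {1..T} t\<bar> \<partial>lborel)"
    unfolding eq[symmetric] by (intro ennreal_leI integral_abs_bound)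
  also have "\<dots> = (\<integral>\<^sup>+t. ennreal \<bar>?h' t * indicator {1..T} t\<bar> \<partial>lborel)"
    using int by (intro nn_integral_eq_integral[symmetric]) auto
  also have "\<dots> \<le> (\<integral>\<^sup>+t. ennreal (norm y * \<sigma>) * (ennreal (t powr - (e / (\<gamma> - 1))) * indicator {1..} t
      + ennreal (\<sigma> powr - \<gamma>) * (ennreal (t powr e * norm (g (t *\<^sub>R y)) powr \<gamma>) * indicator {1..} t)) \<partial>lborel)"
  proof (rule nn_integral_mono)
    fix t :: real
    show "ennreal \<bar>?h' t * indicator {1..T} t\<bar> \<le> ennreal (norm y * \<sigma>) * (ennreal (t powr - (e / (\<gamma> - 1))) * indicator {1..} t
      + ennreal (\<sigma> powr - \<gamma>) * (ennreal (t powr e * norm (g (t *\<^sub>R y)) powr \<gamma>) * indicator {1..} t))"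
    proof (cases "t \<in> {1..T}")
      case True
      let ?w = "norm (g (t *\<^sub>R y))"
      have "\<bar>?h' t\<bar> \<le> norm y * ?w" using Cauchy_Schwarz_ineq2[of "g (t *\<^sub>R y)" y] by (simp add: mult.commute)
      also have "\<dots> \<le> norm y * (\<sigma> * (t powr - (e / (\<gamma> - 1)) + \<sigma> powr - \<gamma> * (t powr e * ?w powr \<gamma>)))"
        using True lam gamma_gt_1 by (intro mult_left_mono weighted_young_inequality) auto
      finally have "ennreal \<bar>?h' t\<bar> \<le> ennreal (norm y * \<sigma> * (t powr - (e / (\<gamma> - 1)) + \<sigma> powr - \<gamma> * (t powr e * ?w powr \<gamma>)))"
        by (intro ennreal_leI) (simp add: mult.assoc)
      also have "\<dots> = ennreal (norm y * \<sigma>) * (ennreal (t powr - (e / (\<gamma> - 1)))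
          + ennreal (\<sigma> powr - \<gamma>) * ennreal (t powr e * ?w powr \<gamma>))"
        using lam by (simp add: ennreal_mult)
      finally show ?thesis using True by simp
    qed simp
  qed
  also have "\<dots> = ennreal (norm y * \<sigma>) * ((\<integral>\<^sup>+t. ennreal (t powr - (e / (\<gamma> - 1))) * indicator {1..} t \<partial>lborel)
      + ennreal (\<sigma> powr - \<gamma>) * ray_energy e y)"
  proof -
    have meas: "(\<lambda>t::real. ennreal (t powr - (e / (\<gamma> - 1))) * indicator {1..} t) \<in> borel_measurable lborel"
      "(\<lambda>t. ennreal (t powr e * norm (g (t *\<^sub>R y)) powr \<gamma>) * indicator {1..} t) \<in> borel_measurable lborel"
      by measurable
    show ?thesis unfolding ray_energy_def
      by (simp only: nn_integral_cmult nn_integral_add borel_measurable_times_ennreal borel_measurable_add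
          borel_measurable_const meas)
  qed
  also have "\<dots> = ennreal (norm y * \<sigma> * (1 / (e / (\<gamma> - 1) - 1) + \<sigma> powr - \<gamma> * m))"
    using lam m(2) a by (simp add: nn_integral_powr_tail[OF a] m(1) ennreal_mult)
  finally show ?thesis
    using lam m(2) a by (subst (asm) ennreal_le_iff) (auto intro!: mult_nonneg_nonneg add_nonneg_nonneg)
qed

text \<open>For a positive exponent \<open>p + 1 - \<gamma>\<close> the claim is immediate.  Otherwise \<open>u\<close> would have to become
unbounded, or the constant 1 to tend to zero, whereas finite ray energy keeps \<open>u\<close> bounded on the
ray: the premises contradict each other.\<close>

lemma tendsto_0_along_ray:
  assumes e: "\<gamma> - 1 < e" and fin: "ray_energy e y < \<infinity>"
    and lim: "(\<lambda>j. u (2 ^ j *\<^sub>R y) powr (p + 1 - \<gamma>)) \<longlonglongrightarrow> 0"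
  shows "(\<lambda>j. u (2 ^ j *\<^sub>R y)) \<longlonglongrightarrow> 0"
proof (cases "p + 1 - \<gamma> > 0")
  case True
  let ?q = "p + 1 - \<gamma>"
  have "(\<lambda>j. (u (2 ^ j *\<^sub>R y) powr ?q) powr (1 / ?q)) \<longlonglongrightarrow> 0 powr (1 / ?q)"
    using True by (intro tendsto_powr2[OF lim]) auto
  then show ?thesis using True pos by (simp add: powr_powr less_imp_le)
next
  case False
  obtain m where m: "ray_energy e y = ennreal m" "m \<ge> 0" using fin by (cases "ray_energy e y") auto
  \<comment> \<open>An upper bound for \<open>u\<close> on the ray, from the oscillation bound with \<open>\<sigma> = 1\<close>.\<close>
  define B where "B = u y + norm y * 1 * (1 / (e / (\<gamma> - 1) - 1) + 1 powr - \<gamma> * m)"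
  have "u (2 ^ j *\<^sub>R y) \<le> B" for j
    using ray_oscillation_le[OF _ _ e m, of 1 "2 ^ j"] by (simp add: B_def)
  then have "B powr (p + 1 - \<gamma>) \<le> u (2 ^ j *\<^sub>R y) powr (p + 1 - \<gamma>)" for j
    using False pos by (intro powr_mono2') auto
  then have "B powr (p + 1 - \<gamma>) \<le> 0" by (intro LIMSEQ_le_const[OF lim]) auto
  moreover have "B > 0" using pos[of "2 ^ 0 *\<^sub>R y"] \<open>u (2 ^ 0 *\<^sub>R y) \<le> B\<close> by linarith
  ultimately show ?thesis by simp
qed

text \<open>Letting \<open>j\<close> tend to infinity in the oscillation bound gives a bound for \<open>u(y)\<close> itself for each \<open>\<sigma>\<close>.
The choice \<open>\<sigma>^\<gamma> = m\<close> makes it homogeneous; the case \<open>m = 0\<close> cannot occur, as small \<open>\<sigma>\<close> would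
violate the positivity of \<open>u(y)\<close>.\<close>

lemma hardy_along_ray:
  assumes e: "\<gamma> - 1 < e" and m: "ray_energy e y = ennreal m" "m \<ge> 0"
    and lim: "(\<lambda>j. u (2 ^ j *\<^sub>R y)) \<longlonglongrightarrow> 0"
  shows "(u y / norm y) powr \<gamma> \<le> (1 / (e / (\<gamma> - 1) - 1) + 1) powr \<gamma> * m"
proof -
  define C where "C = 1 / (e / (\<gamma> - 1) - 1)"
  have C: "C > 0" using e gamma_gt_1 by (simp add: C_def)
  have le: "u y \<le> norm y * \<sigma> * (C + \<sigma> powr - \<gamma> * m)" if lam: "\<sigma> > 0" for \<sigma>
  proof -
    have "u y \<le> u (2 ^ j *\<^sub>R y) + norm y * \<sigma> * (C + \<sigma> powr - \<gamma> * m)" for j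
      using ray_oscillation_le[OF lam _ e m, of "2 ^ j"] by (simp add: C_def)
    moreover have "(\<lambda>j. u (2 ^ j *\<^sub>R y) + norm y * \<sigma> * (C + \<sigma> powr - \<gamma> * m)) \<longlonglongrightarrow> 0 + norm y * \<sigma> * (C + \<sigma> powr - \<gamma> * m)"
      by (intro tendsto_intros lim)
    ultimately show ?thesis by (intro LIMSEQ_le_const[of _ _ "u y"]) auto
  qed
  have y: "norm y > 0" using le[of 1] pos[of y] by (cases "y = 0") auto
  have "m \<noteq> 0"
  proof
    assume "m = 0"
    \<comment> \<open>This value of \<open>\<sigma>\<close> would give \<open>u y \<le> u y / 2\<close>.\<close>
    have "norm y * (u y / (2 * (norm y * C))) * C < u y" using y C pos[of y] by simp
    moreover have "u y / (2 * (norm y * C)) > 0" using y C pos[of y] by (intro divide_pos_pos mult_pos_pos) auto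
    ultimately show False using le[of "u y / (2 * (norm y * C))"] \<open>m = 0\<close> by simp
  qed
  then have m0: "m > 0" using m by simp
  define \<sigma> where "\<sigma> = m powr (1 / \<gamma>)"
  have lam: "\<sigma> > 0" "\<sigma> powr \<gamma> = m" "\<sigma> powr - \<gamma> * m = 1"
    using m0 gamma_gt_1 by (auto simp: \<sigma>_def powr_powr powr_minus_divide)
  have "u y \<le> norm y * \<sigma> * (C + 1)" using le[OF lam(1)] unfolding lam(3) .
  then have "u y / norm y \<le> \<sigma> * (C + 1)" using y by (simp add: field_simps)
  then have "(u y / norm y) powr \<gamma> \<le> (\<sigma> * (C + 1)) powr \<gamma>"
    using pos[of y] gamma_gt_1 by (intro powr_mono2) (auto simp: less_imp_le)
  also have "\<dots> = (C + 1) powr \<gamma> * m" using lam C by (simp add: powr_mult)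
  finally show ?thesis by (simp add: C_def)
qed

text \<open>The exponent \<open>e\<close> has to lie strictly between \<open>\<gamma> - 1\<close> and \<open>n - 1\<close>; this is where \<open>\<gamma> < n\<close> is used.\<close>

theorem hardy_inequality:
  assumes dim: "\<gamma> < real DIM('a)"
    and energy: "(\<integral>\<^sup>+x. ennreal (norm (g x) powr \<gamma>) \<partial>lborel) < \<infinity>"
  shows "integrable lborel (\<lambda>x. (u x / norm x) powr \<gamma>)"
proof -
  define e where "e = (\<gamma> + real DIM('a)) / 2 - 1"
  have e: "\<gamma> - 1 < e" "e < real DIM('a) - 1" using dim by (auto simp: e_def)
  let ?C = "(1 / (e / (\<gamma> - 1) - 1) + 1) powr \<gamma>"
  have fin: "(\<integral>\<^sup>+y. ray_energy e y \<partial>lborel) < \<infinity>"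
    using energy by (simp add: nn_integral_ray_energy[OF e(2)] ennreal_mult_less_top)
  then have "AE y in lborel. ray_energy e y \<noteq> \<infinity>"
    by (intro nn_integral_PInf_AE) auto
  with AE_reaction_tendsto_0
  have "AE y in lborel. ennreal ((u y / norm y) powr \<gamma>) \<le> ennreal ?C * ray_energy e y"
  proof eventually_elim
    case (elim y)
    obtain m where m: "ray_energy e y = ennreal m" "m \<ge> 0" using elim(2) by (cases "ray_energy e y") auto
    have "ray_energy e y < \<infinity>" using m by simp
    from hardy_along_ray[OF e(1) m tendsto_0_along_ray[OF e(1) this elim(1)]]
    show ?case using m by (simp add: ennreal_mult[symmetric] ennreal_leI)
  qed
  then have "(\<integral>\<^sup>+y. ennreal ((u y / norm y) powr \<gamma>) \<partial>lborel) \<le> (\<integral>\<^sup>+y. ennreal ?C * ray_energy e y \<partial>lborel)"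
    by (rule nn_integral_mono_AE)
  also have "\<dots> = ennreal ?C * (\<integral>\<^sup>+y. ray_energy e y \<partial>lborel)" by (rule nn_integral_cmult) measurable
  also have "\<dots> < \<infinity>" using fin by (simp add: ennreal_mult_less_top)
  finally show ?thesis by (intro integrableI_bounded) auto
qed

end

section \<open>Energy and Pohozaev identities\<close>

text \<open>A product rule in which one factor is only continuous: this suffices where the other factor vanishes.
It makes the Pohozaev field differentiable at the zeros of the flux, where \<open>g\<close> is continuous but
need not be differentiable.\<close>

lemma has_derivative_bilinear_vanishing:
  assumes bl: "bounded_bilinear B" and c: "isCont c x"
    and f: "(f has_derivative f') (at x)" "f x = 0"
  shows "((\<lambda>y. B (c y) (f y)) has_derivative (\<lambda>v. B (c x) (f' v))) (at x)"
proof -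
  interpret bounded_bilinear B by (rule bl)
  have f'bl: "bounded_linear f'" using f(1) by (rule has_derivative_bounded_linear)
  have lim: "((\<lambda>y. (f y - f' (y - x)) /\<^sub>R norm (y - x)) \<longlongrightarrow> 0) (at x)"
    using f by (simp add: has_derivative_at2 inverse_eq_divide)
  obtain K where K: "\<And>v. norm (f' v) \<le> norm v * K" using bounded_linear.bounded[OF f'bl] by blast
  have "((\<lambda>y. B (c y) ((f y - f' (y - x)) /\<^sub>R norm (y - x))
      + B (c y - c x) (f' (y - x) /\<^sub>R norm (y - x))) \<longlongrightarrow> B (c x) 0 + 0) (at x)"
  proof (intro tendsto_add tendsto lim)
    show "(c \<longlongrightarrow> c x) (at x)" using c by (simp add: isCont_def)
    have c0: "((\<lambda>y. c y - c x) \<longlongrightarrow> 0) (at x)"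
      using tendsto_diff[OF c[unfolded isCont_def] tendsto_const, of "c x"] by simp
    obtain M where M: "\<And>a b. norm (B a b) \<le> norm a * norm b * M" using bounded by blast
    show "((\<lambda>y. B (c y - c x) (f' (y - x) /\<^sub>R norm (y - x))) \<longlongrightarrow> 0) (at x)"
    proof (rule Lim_null_comparison)
      show "\<forall>\<^sub>F y in at x. norm (B (c y - c x) (f' (y - x) /\<^sub>R norm (y - x))) \<le> norm (c y - c x) * (\<bar>K\<bar> * \<bar>M\<bar>)"
      proof (rule always_eventually, rule allI)
        fix y
        have "norm (f' (y - x)) \<le> norm (y - x) * \<bar>K\<bar>"
          using K[of "y - x"] by (rule order_trans) (intro mult_left_mono, auto)
        then have "norm (f' (y - x) /\<^sub>R norm (y - x)) \<le> \<bar>K\<bar>"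
          by (cases "y = x") (auto simp: field_simps)
        then have "norm (c y - c x) * norm (f' (y - x) /\<^sub>R norm (y - x)) * \<bar>M\<bar> \<le> norm (c y - c x) * \<bar>K\<bar> * \<bar>M\<bar>"
          by (intro mult_right_mono mult_left_mono) auto
        moreover have "norm (B (c y - c x) (f' (y - x) /\<^sub>R norm (y - x)))
            \<le> norm (c y - c x) * norm (f' (y - x) /\<^sub>R norm (y - x)) * \<bar>M\<bar>"
          by (rule order_trans[OF M]) (intro mult_left_mono, auto)
        ultimately show "norm (B (c y - c x) (f' (y - x) /\<^sub>R norm (y - x))) \<le> norm (c y - c x) * (\<bar>K\<bar> * \<bar>M\<bar>)"
          by (simp add: mult.assoc)
      qed
      show "((\<lambda>y. norm (c y - c x) * (\<bar>K\<bar> * \<bar>M\<bar>)) \<longlongrightarrow> 0) (at x)"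
        using tendsto_mult_left_zero[OF tendsto_norm_zero[OF c0]] by simp
    qed
  qed
  moreover have "B (c y) ((f y - f' (y - x)) /\<^sub>R norm (y - x)) + B (c y - c x) (f' (y - x) /\<^sub>R norm (y - x))
      = (B (c y) (f y) - B (c x) (f x) - B (c x) (f' (y - x))) /\<^sub>R norm (y - x)" for y
    by (simp add: f(2) diff_left diff_right scaleR_right scaleR_diff_right zero_right)
  moreover have "bounded_linear (\<lambda>v. B (c x) (f' v))"
    using bounded_linear_compose[OF bounded_linear_right f'bl] .
  ultimately show ?thesis
    by (simp add: has_derivative_at2 inverse_eq_divide diff_diff_eq zero_right)
qed

context gamma_laplace_solution
begin

text \<open>The radial part of \<open>u F\<close> is bounded by \<open>|x|\<^sup>2 ((u / |x|)^\<gamma> + |g|^\<gamma>)\<close>, and the Hardy inequality makes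
the bracket integrable.  Integrability of \<open>u^(p+1)\<close> then comes from Fatou's lemma, as its
truncated integrals converge to the energy.\<close>

lemma energy_identity:
  assumes dim: "\<gamma> < real DIM('a)"
    and energy: "(\<integral>\<^sup>+x. ennreal (norm (g x) powr \<gamma>) \<partial>lborel) < \<infinity>"
  shows "integrable lborel (\<lambda>x. u x powr (p + 1))"
    and "(\<integral>x. u x powr (p + 1) \<partial>lborel) = (\<integral>x. norm (g x) powr \<gamma> \<partial>lborel)"
proof -
  let ?e = "\<lambda>x. norm (g x) powr \<gamma>" and ?r = "\<lambda>x. u x powr (p + 1)"
  have int_e: "integrable lborel ?e" using energy by (intro integrableI_bounded) auto
  have int_f: "integrable lborel (\<lambda>x. (u x / norm x) powr \<gamma> + ?e x)"
    using hardy_inequality[OF dim energy] int_e by (rule Bochner_Integration.integrable_add)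
  have ec: "continuous_on UNIV ?e" by (rule continuous_on_g_powr) (use gamma_gt_1 in simp)
  have V': "((\<lambda>x. u x *\<^sub>R F x) has_derivative (\<lambda>w. u x *\<^sub>R F' x w + (g x \<bullet> w) *\<^sub>R F x)) (at x)" for x
    by (rule has_derivative_scaleR[OF u' F'])
  have D: "?e x - ?r x = (\<Sum>b\<in>Basis. (u x *\<^sub>R F' x b + (g x \<bullet> b) *\<^sub>R F x) \<bullet> b)" for x
  proof -
    have "(\<Sum>b\<in>Basis. (u x *\<^sub>R F' x b + (g x \<bullet> b) *\<^sub>R F x) \<bullet> b)
        = u x * (\<Sum>b\<in>Basis. F' x b \<bullet> b) + (\<Sum>b\<in>Basis. (g x \<bullet> b) * (F x \<bullet> b))"
      by (simp add: inner_add_left sum.distrib sum_distrib_left)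
    also have "\<dots> = u x * - (u x powr p) + ?e x"
      by (simp add: div_F euclidean_inner[symmetric] inner_g_F)
    also have "u x * - (u x powr p) = - ?r x" using powr_mult_base[of "u x" p] pos[of x] by (simp add: less_imp_le add.commute)
    finally show ?thesis by simp
  qed
  have Dc: "continuous_on UNIV (\<lambda>x. ?e x - ?r x)"
    by (intro continuous_intros ec continuous_on_u_powr)
  have bound: "\<bar>x \<bullet> (u x *\<^sub>R F x)\<bar> \<le> (norm x)\<^sup>2 * ((u x / norm x) powr \<gamma> + ?e x)" for x
  proof (cases "x = 0")
    case False
    define a where "a = u x / norm x"
    have a: "a > 0" using False pos[of x] by (simp add: a_def)
    let ?b = "norm (g x)"
    have "a * ?b powr (\<gamma> - 1) \<le> a powr \<gamma> + ?b powr \<gamma>"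
    proof (cases "a \<le> ?b")
      case True
      then have "a * ?b powr (\<gamma> - 1) \<le> ?b * ?b powr (\<gamma> - 1)" by (intro mult_right_mono) auto
      also have "\<dots> = ?b powr \<gamma>" using powr_mult_base[of ?b "\<gamma> - 1"] by simp
      finally show ?thesis by (simp add: add_increasing)
    next
      case False
      then have "?b powr (\<gamma> - 1) \<le> a powr (\<gamma> - 1)" using gamma_gt_1 by (intro powr_mono2) auto
      then have "a * ?b powr (\<gamma> - 1) \<le> a * a powr (\<gamma> - 1)" using a by (intro mult_left_mono) auto
      also have "\<dots> = a powr \<gamma>" using powr_mult_base[of a "\<gamma> - 1"] a by simp
      finally show ?thesis by (simp add: add_increasing2)
    qed
    then have "(norm x)\<^sup>2 * (a * ?b powr (\<gamma> - 1)) \<le> (norm x)\<^sup>2 * (a powr \<gamma> + ?b powr \<gamma>)"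
      by (intro mult_left_mono) auto
    moreover have "(norm x)\<^sup>2 * (a * ?b powr (\<gamma> - 1)) = norm x * norm (u x *\<^sub>R F x)"
      using False pos[of x] by (simp add: a_def norm_F power2_eq_square)
    ultimately show ?thesis
      using Cauchy_Schwarz_ineq2[of x "u x *\<^sub>R F x"] by (simp add: a_def)
  qed simp
  let ?c = "\<lambda>j. cutoff 0 (real (Suc j))"
  have t1: "(\<lambda>j. \<integral>x. ?c j x * (?e x - ?r x) \<partial>lborel) \<longlonglongrightarrow> 0"
    by (rule cutoff_divergence_tendsto_0[OF V' D Dc int_f bound])
  have t2: "(\<lambda>j. \<integral>x. ?c j x * ?e x \<partial>lborel) \<longlonglongrightarrow> (\<integral>x. ?e x \<partial>lborel)"
    by (rule cutoff_integral_tendsto[OF int_e])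
  have ic: "integrable lborel (\<lambda>x. ?c j x * ?r x)" for j
    by (rule integrable_cutoff[OF _ continuous_on_u_powr]) simp
  have "(\<integral>x. ?c j x * (?e x - ?r x) \<partial>lborel) = (\<integral>x. ?c j x * ?e x \<partial>lborel) - (\<integral>x. ?c j x * ?r x \<partial>lborel)" for j
    using integrable_cutoff[OF _ ec, of "real (Suc j)" 0] ic[of j] by (simp add: right_diff_distrib)
  then have t3: "(\<lambda>j. \<integral>x. ?c j x * ?r x \<partial>lborel) \<longlonglongrightarrow> (\<integral>x. ?e x \<partial>lborel)"
    using tendsto_diff[OF t2 t1] by simp
  have "(\<integral>\<^sup>+x. ennreal (?r x) \<partial>lborel) = (\<integral>\<^sup>+x. liminf (\<lambda>j. ennreal (?c j x * ?r x)) \<partial>lborel)"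
  proof (rule nn_integral_cong)
    fix x
    have "(\<lambda>j. ennreal (?c j x * ?r x)) \<longlonglongrightarrow> ennreal (1 * ?r x)"
      by (intro tendsto_ennrealI tendsto_intros cutoff_tendsto_1)
    then show "ennreal (?r x) = liminf (\<lambda>j. ennreal (?c j x * ?r x))"
      by (intro lim_imp_Liminf[symmetric]) auto
  qed
  also have "\<dots> \<le> liminf (\<lambda>j. \<integral>\<^sup>+x. ennreal (?c j x * ?r x) \<partial>lborel)"
    by (rule nn_integral_liminf) (use ic in \<open>auto dest: borel_measurable_integrable\<close>)
  also have "(\<lambda>j. \<integral>\<^sup>+x. ennreal (?c j x * ?r x) \<partial>lborel) = (\<lambda>j. ennreal (\<integral>x. ?c j x * ?r x \<partial>lborel))"
    using ic by (intro ext nn_integral_eq_integral) (auto simp: cutoff_nonneg)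
  also have "liminf \<dots> = ennreal (\<integral>x. ?e x \<partial>lborel)"
    by (intro lim_imp_Liminf tendsto_ennrealI t3) simp
  finally have "(\<integral>\<^sup>+x. ennreal (?r x) \<partial>lborel) < \<infinity>" by (rule le_less_trans) simp
  then show int_r: "integrable lborel ?r" by (intro integrableI_bounded) auto
  show "(\<integral>x. ?r x \<partial>lborel) = (\<integral>x. ?e x \<partial>lborel)"
    using LIMSEQ_unique[OF cutoff_integral_tendsto[OF int_r, of 0] t3] .
qed

definition pohozaev_field :: "'a \<Rightarrow> 'a" where
  "pohozaev_field x = (x \<bullet> g x) *\<^sub>R F x - (norm (g x) powr \<gamma> / \<gamma>) *\<^sub>R x + (u x powr (p + 1) / (p + 1)) *\<^sub>R x"

definition pohozaev_density :: "'a \<Rightarrow> real" where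
  "pohozaev_density x = (1 - real DIM('a) / \<gamma>) * norm (g x) powr \<gamma> + real DIM('a) / (p + 1) * u x powr (p + 1)"

lemma sum_inner_Basis_self: "(\<Sum>b\<in>(Basis::'a set). b \<bullet> b) = real DIM('a)"
  by simp

lemma pohozaev_divergence_critical:
  assumes x: "F x = 0"
  shows "\<exists>W'. (pohozaev_field has_derivative W') (at x) \<and> pohozaev_density x = (\<Sum>b\<in>Basis. W' b \<bullet> b)"
proof -
  have g0: "g x = 0" using x g_eq[of x] by (simp add: G_def)
  have gc: "isCont g x" using continuous_on_g[of UNIV] by (simp add: continuous_on_eq_continuous_at)
  have 1: "((\<lambda>y. (y \<bullet> g y) *\<^sub>R F y) has_derivative (\<lambda>v. (x \<bullet> g x) *\<^sub>R F' x v)) (at x)"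
    by (rule has_derivative_bilinear_vanishing[OF bounded_bilinear_scaleR _ F' x])
       (intro continuous_intros gc)
  have 2: "((\<lambda>y. g y \<bullet> F y) has_derivative (\<lambda>v. g x \<bullet> F' x v)) (at x)"
    by (rule has_derivative_bilinear_vanishing[OF bounded_bilinear_inner gc F' x])
  have 3: "((\<lambda>y. (norm (g y) powr \<gamma> / \<gamma>) *\<^sub>R y) has_derivative (\<lambda>v. 0)) (at x)"
    unfolding inner_g_F[symmetric]
    by (rule has_derivative_eq_rhs[OF has_derivative_scaleR[OF bounded_linear.has_derivative[OF bounded_linear_divide, OF 2] has_derivative_ident]])
       (simp add: g0)
  have 4: "((\<lambda>y. (u y powr (p + 1) / (p + 1)) *\<^sub>R y) has_derivative (\<lambda>v. (u x powr (p + 1) / (p + 1)) *\<^sub>R v)) (at x)"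
    by (rule has_derivative_eq_rhs[OF has_derivative_scaleR[OF bounded_linear.has_derivative[OF bounded_linear_divide, OF has_derivative_u_powr] has_derivative_ident]])
       (simp add: g0)
  have "(pohozaev_field has_derivative (\<lambda>v. (u x powr (p + 1) / (p + 1)) *\<^sub>R v)) (at x)"
    unfolding pohozaev_field_def[abs_def]
    by (rule has_derivative_eq_rhs[OF has_derivative_add[OF has_derivative_diff[OF 1 3] 4]]) (simp add: g0)
  moreover have "pohozaev_density x = (\<Sum>b\<in>(Basis::'a set). ((u x powr (p + 1) / (p + 1)) *\<^sub>R b) \<bullet> b)"
    by (simp add: pohozaev_density_def g0)
  ultimately show ?thesis by blast
qed

text \<open>The Hessian \<open>H\<close> of \<open>u\<close> enters through \<open>x \<bullet> H F\<close>, from the first term of the field, and through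
\<open>F \<bullet> H x\<close>, from the second one.  They cancel by symmetry, and the terms with \<open>x \<bullet> g\<close> cancel by the
equation.\<close>

lemma pohozaev_divergence_regular:
  assumes p: "p > 0" and x: "F x \<noteq> 0"
  shows "\<exists>W'. (pohozaev_field has_derivative W') (at x) \<and> pohozaev_density x = (\<Sum>b\<in>Basis. W' b \<bullet> b)"
proof -
  have g0: "g x \<noteq> 0" using x by (auto simp: F_eq)
  have "G differentiable (at (F x))"
  proof -
    let ?a = "(2 - \<gamma>) / (\<gamma> - 1)"
    have "((\<lambda>s. s powr ?a) has_derivative (*) (?a * norm (F x) powr (?a - 1))) (at (norm (F x)))"
      unfolding has_field_derivative_def[symmetric]
      by (rule has_real_derivative_powr) (use x in simp)
    from has_derivative_scaleR[OF has_derivative_compose[OF has_derivative_norm[OF x] this] has_derivative_ident]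
    show ?thesis unfolding G_def[abs_def] differentiable_def by blast
  qed
  then obtain G' where "(G has_derivative G') (at (F x))" by (auto simp: differentiable_def)
  from has_derivative_compose[OF F' this] have gH: "(g has_derivative (\<lambda>v. G' (F' x v))) (at x)"
    unfolding g_eq[abs_def] by (simp add: g_eq[symmetric])
  define H where "H v = G' (F' x v)" for v
  have H: "(g has_derivative H) (at x)" using gH unfolding H_def[abs_def] .
  have lin: "linear H" using H by (rule has_derivative_linear)
  have sym: "H w \<bullet> v = H v \<bullet> w" for v w by (rule second_derivative_symmetric[OF u' H])
  have 1: "((\<lambda>y. (y \<bullet> g y) *\<^sub>R F y) has_derivative (\<lambda>v. (x \<bullet> g x) *\<^sub>R F' x v + (x \<bullet> H v + v \<bullet> g x) *\<^sub>R F x)) (at x)"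
    by (rule has_derivative_scaleR[OF has_derivative_inner[OF has_derivative_ident H] F'])
  have 2: "((\<lambda>y. norm (g y) powr \<gamma>) has_derivative (\<lambda>v. \<gamma> * (F x \<bullet> H v))) (at x)"
  proof -
    have n: "((\<lambda>y. norm (g y)) has_derivative (\<lambda>v. H v \<bullet> sgn (g x))) (at x)"
      by (rule has_derivative_compose[OF H has_derivative_norm[OF g0]])
    have "((\<lambda>s. s powr \<gamma>) has_derivative (*) (\<gamma> * norm (g x) powr (\<gamma> - 1))) (at (norm (g x)))"
      unfolding has_field_derivative_def[symmetric]
      by (rule has_real_derivative_powr) (use g0 in simp)
    from has_derivative_compose[OF n this]
    have "((\<lambda>y. norm (g y) powr \<gamma>) has_derivative (\<lambda>v. \<gamma> * norm (g x) powr (\<gamma> - 1) * (H v \<bullet> sgn (g x)))) (at x)" .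
    moreover have "norm (g x) powr (\<gamma> - 1) * (H v \<bullet> sgn (g x)) = F x \<bullet> H v" for v
    proof -
      have "norm (g x) powr (\<gamma> - 1) *\<^sub>R sgn (g x) = F x"
        using g0 by (simp add: F_eq sgn_div_norm powr_diff power2_eq_square divide_simps)
      then have "H v \<bullet> (norm (g x) powr (\<gamma> - 1) *\<^sub>R sgn (g x)) = H v \<bullet> F x" by simp
      then show ?thesis by (simp add: inner_commute)
    qed
    ultimately show ?thesis by (simp add: mult.assoc)
  qed
  have 3: "((\<lambda>y. (norm (g y) powr \<gamma> / \<gamma>) *\<^sub>R y) has_derivative
      (\<lambda>v. (norm (g x) powr \<gamma> / \<gamma>) *\<^sub>R v + (F x \<bullet> H v) *\<^sub>R x)) (at x)"
    by (rule has_derivative_eq_rhs[OF has_derivative_scaleR[OF bounded_linear.has_derivative[OF bounded_linear_divide, OF 2] has_derivative_ident]])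
       (use gamma_gt_1 in simp)
  have 4: "((\<lambda>y. (u y powr (p + 1) / (p + 1)) *\<^sub>R y) has_derivative
      (\<lambda>v. (u x powr (p + 1) / (p + 1)) *\<^sub>R v + (u x powr p * (g x \<bullet> v)) *\<^sub>R x)) (at x)"
    by (rule has_derivative_eq_rhs[OF has_derivative_scaleR[OF bounded_linear.has_derivative[OF bounded_linear_divide, OF has_derivative_u_powr] has_derivative_ident]])
       (use p in simp)
  let ?W' = "\<lambda>v. ((x \<bullet> g x) *\<^sub>R F' x v + (x \<bullet> H v + v \<bullet> g x) *\<^sub>R F x)
     - ((norm (g x) powr \<gamma> / \<gamma>) *\<^sub>R v + (F x \<bullet> H v) *\<^sub>R x)
     + ((u x powr (p + 1) / (p + 1)) *\<^sub>R v + (u x powr p * (g x \<bullet> v)) *\<^sub>R x)"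
  have "(pohozaev_field has_derivative ?W') (at x)"
    unfolding pohozaev_field_def[abs_def]
    by (rule has_derivative_add[OF has_derivative_diff[OF 1 3] 4])
  moreover have "pohozaev_density x = (\<Sum>b\<in>Basis. ?W' b \<bullet> b)"
  proof -
    have tr: "(\<Sum>b\<in>Basis. (a \<bullet> H b) * (c \<bullet> b)) = a \<bullet> H c" for a c
    proof -
      have "a \<bullet> H c = a \<bullet> H (\<Sum>b\<in>Basis. (c \<bullet> b) *\<^sub>R b)" by (simp add: euclidean_representation)
      then show ?thesis
        by (simp add: linear_sum[OF lin] linear_scale[OF lin] inner_sum_right mult.commute)
    qed
    have "(\<Sum>b\<in>Basis. ?W' b \<bullet> b) = (x \<bullet> g x) * (\<Sum>b\<in>Basis. F' x b \<bullet> b)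
       + (\<Sum>b\<in>Basis. (x \<bullet> H b) * (F x \<bullet> b)) + (\<Sum>b\<in>Basis. (g x \<bullet> b) * (F x \<bullet> b))
       - (norm (g x) powr \<gamma> / \<gamma>) * (\<Sum>b\<in>(Basis::'a set). b \<bullet> b) - (\<Sum>b\<in>Basis. (F x \<bullet> H b) * (x \<bullet> b))
       + (u x powr (p + 1) / (p + 1)) * (\<Sum>b\<in>(Basis::'a set). b \<bullet> b)
       + u x powr p * (\<Sum>b\<in>Basis. (g x \<bullet> b) * (x \<bullet> b))"
      unfolding sum_distrib_left sum.distrib[symmetric] sum_subtractf[symmetric]
      by (intro sum.cong refl) (simp add: inner_add_left inner_diff_left inner_commute algebra_simps)
    also have "\<dots> = pohozaev_density x"
      unfolding tr sum_inner_Basis_self euclidean_inner[symmetric] div_F inner_g_F pohozaev_density_def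
      using sym[of "F x" x] by (simp add: inner_commute algebra_simps)
    finally show ?thesis by simp
  qed
  ultimately show ?thesis by blast
qed

theorem finite_energy_exponent:
  assumes p: "p > 0" and dim: "\<gamma> < real DIM('a)"
    and energy: "(\<integral>\<^sup>+x. ennreal (norm (g x) powr \<gamma>) \<partial>lborel) < \<infinity>"
  shows "p = real DIM('a) * \<gamma> / (real DIM('a) - \<gamma>) - 1"
proof -
  let ?e = "\<lambda>x. norm (g x) powr \<gamma>" and ?r = "\<lambda>x. u x powr (p + 1)" and ?n = "real DIM('a)"
  have int_e: "integrable lborel ?e" using energy by (intro integrableI_bounded) auto
  note int_r = energy_identity(1)[OF dim energy]
  have ec: "continuous_on UNIV ?e" by (rule continuous_on_g_powr) (use gamma_gt_1 in simp)
  have "\<exists>W'. (pohozaev_field has_derivative W') (at x) \<and> pohozaev_density x = (\<Sum>b\<in>Basis. W' b \<bullet> b)" for x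
    using pohozaev_divergence_critical pohozaev_divergence_regular[OF p] by blast
  then obtain W' where W': "\<And>x. (pohozaev_field has_derivative W' x) (at x)"
    and D: "\<And>x. pohozaev_density x = (\<Sum>b\<in>Basis. W' x b \<bullet> b)" by metis
  have Dc: "continuous_on UNIV pohozaev_density"
    unfolding pohozaev_density_def[abs_def]
    by (intro continuous_intros ec continuous_on_u_powr)
  have int_D: "integrable lborel pohozaev_density"
    unfolding pohozaev_density_def[abs_def]
    by (intro Bochner_Integration.integrable_add integrable_mult_right int_e int_r)
  have int_f: "integrable lborel (\<lambda>x. (1 + 1 / \<gamma>) * ?e x + 1 / (p + 1) * ?r x)"
    by (intro Bochner_Integration.integrable_add integrable_mult_right int_e int_r)
  have bound: "\<bar>x \<bullet> pohozaev_field x\<bar> \<le> (norm x)\<^sup>2 * ((1 + 1 / \<gamma>) * ?e x + 1 / (p + 1) * ?r x)" for x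
  proof -
    have "\<bar>x \<bullet> g x\<bar> * \<bar>x \<bullet> F x\<bar> \<le> (norm x * norm (g x)) * (norm x * norm (F x))"
      by (intro mult_mono Cauchy_Schwarz_ineq2) auto
    also have "\<dots> = (norm x)\<^sup>2 * ?e x"
      using powr_mult_base[of "norm (g x)" "\<gamma> - 1"] by (simp add: norm_F power2_eq_square)
    finally have "\<bar>(x \<bullet> g x) * (x \<bullet> F x)\<bar> \<le> (norm x)\<^sup>2 * ?e x" by (simp add: abs_mult)
    moreover have "x \<bullet> pohozaev_field x = (x \<bullet> g x) * (x \<bullet> F x) - (norm x)\<^sup>2 * (?e x / \<gamma>) + (norm x)\<^sup>2 * (?r x / (p + 1))"
      by (simp add: pohozaev_field_def inner_add_right inner_diff_right power2_norm_eq_inner mult.commute)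
    moreover have "0 \<le> (norm x)\<^sup>2 * (?e x / \<gamma>)" "0 \<le> (norm x)\<^sup>2 * (?r x / (p + 1))"
      using gamma_gt_1 p by auto
    moreover have "(norm x)\<^sup>2 * ((1 + 1 / \<gamma>) * ?e x + 1 / (p + 1) * ?r x)
        = (norm x)\<^sup>2 * ?e x + (norm x)\<^sup>2 * (?e x / \<gamma>) + (norm x)\<^sup>2 * (?r x / (p + 1))"
      by (simp add: algebra_simps)
    ultimately show ?thesis by linarith
  qed
  define E where "E = (\<integral>x. ?e x \<partial>lborel)"
  have "0 = (\<integral>x. pohozaev_density x \<partial>lborel)"
    by (rule integral_divergence_zero_at_infinity[OF W' D Dc int_f bound int_D, symmetric])
  also have "\<dots> = (1 - ?n / \<gamma>) * E + ?n / (p + 1) * E"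
    unfolding pohozaev_density_def using int_e int_r energy_identity(2)[OF dim energy] by (simp add: E_def)
  finally have id: "((1 - ?n / \<gamma>) + ?n / (p + 1)) * E = 0" by (simp add: distrib_right)
  \<comment> \<open>The energy equals the integral of a positive function.\<close>
  have "E \<noteq> 0"
  proof
    assume "E = 0"
    then have "(\<integral>x. ?r x \<partial>lborel) = 0" using energy_identity(2)[OF dim energy] by (simp add: E_def)
    then have "AE x in lborel. ?r x = 0"
      using int_r by (subst (asm) integral_nonneg_eq_0_iff_AE) auto
    then have "AE x in (lborel::'a measure). False" using pos by (auto simp: less_imp_neq[THEN not_sym])
    then have "ae_filter (lborel::'a measure) = bot" by (simp add: trivial_limit_def)
    then show False by (simp add: ae_filter_eq_bot_iff)
  qed
  then have "1 - ?n / \<gamma> + ?n / (p + 1) = 0" using id by simp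
  then have "?n / (p + 1) = (?n - \<gamma>) / \<gamma>" using gamma_gt_1 by (simp add: field_simps)
  then have "p + 1 = ?n * \<gamma> / (?n - \<gamma>)" using gamma_gt_1 p dim by (simp add: field_simps)
  then show ?thesis by simp
qed

end

section \<open>The radial solution of the critical equation\<close>

text \<open>At the origin the right-hand side vanishes whatever the value of \<open>0 powr (s - 2)\<close>, and there the
derivative is indeed 0 because \<open>s > 1\<close>.\<close>

lemma has_derivative_norm_powr:
  fixes x :: "'a::euclidean_space"
  assumes s: "s > 1"
  shows "((\<lambda>y. norm y powr s) has_derivative (\<lambda>v. s * norm x powr (s - 2) * (x \<bullet> v))) (at x)"
proof (cases "x = 0")
  case True
  have "((\<lambda>y::'a. norm y powr (s - 1)) \<longlongrightarrow> 0 powr (s - 1)) (at 0)"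
    by (rule tendsto_powr2) (use s in \<open>auto intro!: tendsto_norm_zero tendsto_ident_at\<close>)
  moreover have "\<forall>\<^sub>F y in at (0::'a). norm y powr (s - 1) = norm (norm y powr s) / norm y"
    by (auto simp: eventually_at_filter powr_diff)
  ultimately have "((\<lambda>y::'a. norm (norm y powr s) / norm y) \<longlongrightarrow> 0) (at 0)"
    by (auto intro: Lim_transform_eventually)
  then show ?thesis using True by (simp add: has_derivative_iff_norm)
next
  case False
  have "((\<lambda>r. r powr s) has_derivative (*) (s * norm x powr (s - 1))) (at (norm x))"
    unfolding has_field_derivative_def[symmetric]
    by (rule has_real_derivative_powr) (use False in simp)
  from has_derivative_compose[OF has_derivative_norm[OF False] this]
  show ?thesis
    by (rule has_derivative_eq_rhs)
       (use False in \<open>auto simp: fun_eq_iff sgn_div_norm powr_diff power2_eq_square inner_commute field_simps\<close>)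
qed

text \<open>Comparison with a step function that is constant on dyadic shells.\<close>

lemma nn_integral_norm_powr_finite:
  fixes f :: "'a::euclidean_space \<Rightarrow> real"
  assumes \<alpha>: "\<alpha> > real DIM('a)"
    and f1: "\<And>x. f x \<le> 1" and f2: "\<And>x. 1 \<le> norm x \<Longrightarrow> f x \<le> norm x powr - \<alpha>"
  shows "(\<integral>\<^sup>+x. ennreal (f x) \<partial>lborel) < \<infinity>"
proof -
  let ?n = "DIM('a)"
  let ?a = "\<lambda>k. 2 powr \<alpha> * (2 powr - \<alpha>) ^ k"
  let ?v = "measure lborel (ball (0::'a) 1)"
  have ex: "\<exists>k. f x \<le> ?a k \<and> norm x < 2 ^ k" for x
  proof (cases "norm x < 1")
    case True
    have "(1::real) \<le> 2 powr \<alpha>" using \<alpha> by (intro ge_one_powr_ge_zero) auto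
    then show ?thesis using True f1[of x] by (intro exI[of _ 0]) simp
  next
    case False
    define k where "k = (LEAST k. norm x < 2 ^ k)"
    have k: "norm x < 2 ^ k"
      unfolding k_def by (rule LeastI_ex) (simp add: real_arch_pow)
    have "k \<noteq> 0" using k False by (cases k) auto
    then obtain j where j: "k = Suc j" by (cases k) auto
    have "\<not> norm x < 2 ^ j" using not_less_Least[of j "\<lambda>k. norm x < 2 ^ k"] j by (simp add: k_def)
    then have "f x \<le> (2 ^ j) powr - \<alpha>"
      using f2[of x] False powr_mono2'[of "- \<alpha>" "2 ^ j" "norm x"] \<alpha> by simp
    also have "(2 ^ j) powr - \<alpha> = ?a k"
      using j by (simp add: powr_powr powr_realpow[symmetric] mult.commute powr_minus field_simps)
    finally show ?thesis using k by blast
  qed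
  have "(\<integral>\<^sup>+x. ennreal (f x) \<partial>lborel) \<le> (\<integral>\<^sup>+x. (\<Sum>k. ennreal (?a k) * indicator (ball (0::'a) (2 ^ k)) x) \<partial>lborel)"
  proof (rule nn_integral_mono)
    fix x :: 'a
    obtain k where k: "f x \<le> ?a k" "norm x < 2 ^ k" using ex by blast
    have "ennreal (f x) \<le> (\<Sum>k\<in>{k}. ennreal (?a k) * indicator (ball (0::'a) (2 ^ k)) x)"
      using k by (simp add: ennreal_leI)
    also have "\<dots> \<le> (\<Sum>k. ennreal (?a k) * indicator (ball (0::'a) (2 ^ k)) x)"
      by (rule sum_le_suminf) auto
    finally show "ennreal (f x) \<le> (\<Sum>k. ennreal (?a k) * indicator (ball (0::'a) (2 ^ k)) x)" .
  qed
  also have "\<dots> = (\<Sum>k. ennreal (?a k) * emeasure lborel (ball (0::'a) (2 ^ k)))"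
  proof -
    have "(\<integral>\<^sup>+x. (\<Sum>k. ennreal (?a k) * indicator (ball (0::'a) (2 ^ k)) x) \<partial>lborel)
        = (\<Sum>k. \<integral>\<^sup>+x. ennreal (?a k) * indicator (ball (0::'a) (2 ^ k)) x \<partial>lborel)"
      by (rule nn_integral_suminf, intro borel_measurable_times_ennreal borel_measurable_const
          borel_measurable_indicator) (simp only: sets_lborel borel_open open_ball)
    then show ?thesis by (simp only: nn_integral_cmult_indicator sets_lborel borel_open open_ball)
  qed
  also have "\<dots> = (\<Sum>k. ennreal (2 powr \<alpha> * ?v * (2 powr (real ?n - \<alpha>)) ^ k))"
  proof (rule suminf_cong)
    fix k
    have vol: "emeasure lborel (ball (0::'a) (2 ^ k)) = ennreal ((2 ^ k) ^ ?n * ?v)"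
      using emeasure_lborel_ball_finite[of "0::'a" "2 ^ k"] content_ball_conv_unit_ball[of "2 ^ k" "0::'a"]
      by (subst emeasure_eq_ennreal_measure) auto
    have "(2::real) powr (real ?n - \<alpha>) = 2 ^ ?n * 2 powr - \<alpha>"
      by (simp add: powr_diff powr_realpow powr_minus_divide)
    moreover have "((2::real) ^ k) ^ ?n = (2 ^ ?n) ^ k"
      unfolding power_mult[symmetric] by (simp only: mult.commute)
    ultimately have "?a k * ((2 ^ k) ^ ?n * ?v) = 2 powr \<alpha> * ?v * (2 powr (real ?n - \<alpha>)) ^ k"
      by (simp only: power_mult_distrib ac_simps)
    then show "ennreal (?a k) * emeasure lborel (ball (0::'a) (2 ^ k)) = ennreal (2 powr \<alpha> * ?v * (2 powr (real ?n - \<alpha>)) ^ k)"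
      unfolding vol by (simp add: ennreal_mult[symmetric])
  qed
  also have "\<dots> < \<infinity>"
  proof -
    have "2 powr (real ?n - \<alpha>) < 1" using \<alpha> by (simp add: powr_less_one)
    then have "summable (\<lambda>k. 2 powr \<alpha> * ?v * (2 powr (real ?n - \<alpha>)) ^ k)"
      by (intro summable_mult summable_geometric) simp
    then show ?thesis by (simp add: ennreal_suminf_neq_top less_top)
  qed
  finally show ?thesis .
qed

text \<open>With \<open>N = 1 + |x|^s\<close> the powers of \<open>|x|\<close> in the flux cancel since \<open>(s - 1) (\<gamma> - 1) = 1\<close>, so the flux
is \<open>x\<close> times a power of \<open>N\<close>, which is differentiable everywhere.  Its divergence is again a
multiple of a power of \<open>N\<close>, and the constant \<open>c\<close> adjusts the factor.\<close>

theorem radial_solution_exists: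
  fixes \<gamma> p :: real
  assumes gamma: "1 < \<gamma>" "\<gamma> < real DIM('a::euclidean_space)"
    and p: "p = real DIM('a) * \<gamma> / (real DIM('a) - \<gamma>) - 1"
  shows "\<exists>(u :: 'a \<Rightarrow> real) g F F'. gamma_laplace_solution u g F F' \<gamma> p \<and>
    (\<integral>\<^sup>+x. ennreal (norm (g x) powr \<gamma>) \<partial>lborel) < \<infinity>"
proof -
  let ?n = "real DIM('a)"
  define s where "s = \<gamma> / (\<gamma> - 1)"
  define \<kappa> where "\<kappa> = (?n - \<gamma>) / \<gamma>"
  have s: "s > 1" using gamma by (simp add: s_def)
  have kap: "\<kappa> > 0" using gamma by (simp add: \<kappa>_def)
  have e1: "(s - 1) * (\<gamma> - 1) = 1" using gamma by (simp add: s_def field_simps)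
  have e2: "(\<kappa> + 1) * (\<gamma> - 1) = ?n / s" using gamma by (simp add: s_def \<kappa>_def field_simps)
  have e3: "(\<kappa> + 1) * \<gamma> = ?n" using gamma by (simp add: \<kappa>_def field_simps)
  have e4: "(s - 1) * \<gamma> = s" using gamma by (simp add: s_def field_simps)
  have e5: "\<kappa> * p = ?n / s + 1"
  proof -
    have "\<kappa> * (p + 1) = ?n" using gamma by (simp add: p \<kappa>_def)
    then have "\<kappa> * p = ?n - \<kappa>" by (simp add: algebra_simps)
    then show ?thesis using gamma by (simp add: s_def \<kappa>_def field_simps)
  qed
  have e6: "p + 1 - \<gamma> > 0"
  proof -
    have "p + 1 - \<gamma> = \<gamma> * \<gamma> / (?n - \<gamma>)" using gamma by (simp add: p field_simps)
    then show ?thesis using gamma by simp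
  qed
  define K where "K = (\<kappa> * s) powr (\<gamma> - 1) * ?n"
  have K: "K > 0" using kap s by (auto simp: K_def intro!: mult_pos_pos)
  define c where "c = K powr (1 / (p + 1 - \<gamma>))"
  have c: "c > 0" using K by (simp add: c_def)
  define A where "A = c * \<kappa> * s"
  have A: "A > 0" using c kap s by (simp add: A_def)
  \<comment> \<open>The choice of \<open>c\<close> solves this equation; the difference of the exponents of \<open>c\<close> on both sides is
    \<open>p + 1 - \<gamma>\<close>, which is positive.\<close>
  have cp: "A powr (\<gamma> - 1) * ?n = c powr p"
  proof -
    have "c powr (p + 1 - \<gamma>) = K" using K e6 by (simp add: c_def powr_powr)
    then have "c powr p = c powr (\<gamma> - 1) * K"
      using powr_add[of c "\<gamma> - 1" "p + 1 - \<gamma>"] by simp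
    then show ?thesis using c kap s by (simp add: A_def K_def powr_mult mult.assoc)
  qed
  define N where "N x = 1 + norm x powr s" for x :: 'a
  have N: "N x \<ge> 1" "N x > 0" for x by (auto simp: N_def intro: add_pos_nonneg)
  have N': "(N has_derivative (\<lambda>v. s * norm x powr (s - 2) * (x \<bullet> v))) (at x)" for x
    unfolding N_def[abs_def]
    by (rule has_derivative_eq_rhs[OF has_derivative_add[OF has_derivative_const has_derivative_norm_powr[OF s]]]) simp
  have Npowr: "((\<lambda>x. N x powr a) has_derivative (\<lambda>v. a * N x powr (a - 1) * (s * norm x powr (s - 2) * (x \<bullet> v)))) (at x)" for a x
  proof -
    have "((\<lambda>r. r powr a) has_derivative (*) (a * N x powr (a - 1))) (at (N x))"
      unfolding has_field_derivative_def[symmetric] by (rule has_real_derivative_powr) (rule N)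
    from has_derivative_compose[OF N' this] show ?thesis .
  qed
  define u where "u x = c * N x powr - \<kappa>" for x
  define g where "g x = - (A * N x powr (- \<kappa> - 1) * norm x powr (s - 2)) *\<^sub>R x" for x
  define F where "F x = - (A powr (\<gamma> - 1) * N x powr - (?n / s)) *\<^sub>R x" for x
  define F' where "F' x v = - (A powr (\<gamma> - 1) * N x powr - (?n / s)) *\<^sub>R v
     + (A powr (\<gamma> - 1) * ?n * N x powr (- (?n / s) - 1) * (norm x powr (s - 2) * (x \<bullet> v))) *\<^sub>R x" for x v
  have norm_g: "norm (g x) = A * N x powr (- \<kappa> - 1) * norm x powr (s - 1)" for x
  proof (cases "x = 0")
    case False
    then have "norm x powr (s - 1) = norm x powr (s - 2) * norm x"
      using powr_mult_base[of "norm x" "s - 2"] by (simp add: mult.commute)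
    then show ?thesis using A by (simp add: g_def abs_mult)
  qed (simp add: g_def)
  have r2: "norm x powr (s - 2) * (x \<bullet> x) = norm x powr s" for x :: 'a
    using powr_add[of "norm x" "s - 2" 2] by (cases "x = 0") (auto simp: power2_norm_eq_inner)
  have "gamma_laplace_solution u g F F' \<gamma> p"
  proof
    show "1 < \<gamma>" by (rule gamma)
    show "0 < u x" for x using c N(2)[of x] by (simp add: u_def)
    show "(u has_derivative (\<lambda>v. g x \<bullet> v)) (at x)" for x
      unfolding u_def[abs_def]
      by (rule has_derivative_eq_rhs[OF has_derivative_mult_right[OF Npowr]])
         (simp add: g_def A_def fun_eq_iff mult_ac)
    show "F x = norm (g x) powr (\<gamma> - 2) *\<^sub>R g x" for x
    proof (cases "x = 0")
      case False
      have "norm (g x) powr (\<gamma> - 2) * (A * N x powr (- \<kappa> - 1) * norm x powr (s - 2))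
        = (A powr (\<gamma> - 2) * A powr 1) * (N x powr ((- \<kappa> - 1) * (\<gamma> - 2)) * N x powr (- \<kappa> - 1))
          * (norm x powr ((s - 1) * (\<gamma> - 2)) * norm x powr (s - 2))"
        unfolding norm_g using A N(2)[of x] False by (simp add: powr_mult powr_powr mult_ac)
      also have "\<dots> = A powr (\<gamma> - 1) * N x powr - (?n / s) * norm x powr 0"
      proof -
        have "(- \<kappa> - 1) * (\<gamma> - 2) + (- \<kappa> - 1) = - (?n / s)" using e2 by (simp add: algebra_simps)
        moreover have "(s - 1) * (\<gamma> - 2) + (s - 2) = 0" using e1 by (simp add: algebra_simps)
        ultimately show ?thesis unfolding powr_add[symmetric] by simp
      qed
      also have "\<dots> = A powr (\<gamma> - 1) * N x powr - (?n / s)" using False by simp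
      finally show ?thesis by (simp add: F_def g_def)
    qed (simp add: F_def g_def)
    show "(F has_derivative F' x) (at x)" for x
      unfolding F_def[abs_def]
      by (rule has_derivative_eq_rhs[OF has_derivative_scaleR[OF
            has_derivative_minus[OF has_derivative_mult_right[OF Npowr]] has_derivative_ident]])
         (use s in \<open>simp add: F'_def fun_eq_iff mult_ac\<close>)
    show "(\<Sum>b\<in>Basis. F' x b \<bullet> b) = - (u x powr p)" for x
    proof -
      let ?M = "N x powr (- (?n / s) - 1)"
      have M: "N x powr - (?n / s) = N x * ?M"
        using powr_mult_base[of "N x" "- (?n / s) - 1"] N(2)[of x] by simp
      have "(\<Sum>b\<in>Basis. F' x b \<bullet> b) = - (A powr (\<gamma> - 1) * N x powr - (?n / s)) * (\<Sum>b\<in>(Basis::'a set). b \<bullet> b)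
          + A powr (\<gamma> - 1) * ?n * ?M * norm x powr (s - 2) * (\<Sum>b\<in>Basis. (x \<bullet> b) * (x \<bullet> b))"
        unfolding F'_def sum_distrib_left sum.distrib[symmetric]
        by (intro sum.cong refl) (simp add: inner_add_left inner_diff_left mult_ac)
      also have "(\<Sum>b\<in>(Basis::'a set). b \<bullet> b) = ?n" by simp
      also have "(\<Sum>b\<in>Basis. (x \<bullet> b) * (x \<bullet> b)) = x \<bullet> x" by (rule euclidean_inner[symmetric])
      also have "- (A powr (\<gamma> - 1) * N x powr - (?n / s)) * ?n + A powr (\<gamma> - 1) * ?n * ?M * norm x powr (s - 2) * (x \<bullet> x)
          = - (A powr (\<gamma> - 1) * ?n) * ?M * (N x - norm x powr (s - 2) * (x \<bullet> x))"
        by (simp add: M algebra_simps)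
      also have "\<dots> = - (c powr p * ?M)" unfolding r2 cp by (simp add: N_def)
      also have "c powr p * ?M = u x powr p"
      proof -
        have "- \<kappa> * p = - (?n / s) - 1" using e5 by simp
        then show ?thesis using c N(2)[of x] by (simp add: u_def powr_mult powr_powr)
      qed
      finally show ?thesis .
    qed
  qed
  moreover have "(\<integral>\<^sup>+x. ennreal (norm (g x) powr \<gamma>) \<partial>lborel) < \<infinity>"
  proof -
    have ge: "norm (g x) powr \<gamma> \<le> A powr \<gamma> * N x powr (1 - ?n)" for x
    proof -
      have "norm (g x) powr \<gamma> = A powr \<gamma> * N x powr ((- \<kappa> - 1) * \<gamma>) * norm x powr ((s - 1) * \<gamma>)"
        unfolding norm_g using A N(2)[of x] by (simp add: powr_mult powr_powr)
      also have "(- \<kappa> - 1) * \<gamma> = - ?n" using e3 by (simp add: algebra_simps)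
      also have "(s - 1) * \<gamma> = s" by (rule e4)
      also have "A powr \<gamma> * N x powr - ?n * norm x powr s \<le> A powr \<gamma> * N x powr - ?n * N x"
        by (intro mult_left_mono) (auto simp: N_def)
      also have "\<dots> = A powr \<gamma> * N x powr (1 - ?n)"
        using powr_mult_base[of "N x" "- ?n"] N(2)[of x] by (simp add: mult.commute)
      finally show ?thesis .
    qed
    have n1: "?n - 1 > 0" using gamma by simp
    have "(\<integral>\<^sup>+x. ennreal (N x powr (1 - ?n)) \<partial>lborel) < \<infinity>"
    proof (rule nn_integral_norm_powr_finite)
      show "s * (?n - 1) > ?n" using gamma by (simp add: s_def field_simps)
      show "N x powr (1 - ?n) \<le> 1" for x
        using N(1)[of x] n1 powr_mono2'[of "1 - ?n" 1 "N x"] by simp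
      show "N x powr (1 - ?n) \<le> norm x powr - (s * (?n - 1))" if "1 \<le> norm x" for x
      proof -
        have "N x powr (1 - ?n) \<le> (norm x powr s) powr (1 - ?n)"
          using n1 that by (intro powr_mono2') (auto simp: N_def)
        then show ?thesis by (simp add: powr_powr algebra_simps)
      qed
    qed
    moreover have "(\<integral>\<^sup>+x. ennreal (norm (g x) powr \<gamma>) \<partial>lborel) \<le> (\<integral>\<^sup>+x. ennreal (A powr \<gamma>) * ennreal (N x powr (1 - ?n)) \<partial>lborel)"
      using ge by (intro nn_integral_mono) (simp add: ennreal_mult[symmetric] ennreal_leI)
    moreover have "(\<integral>\<^sup>+x. ennreal (A powr \<gamma>) * ennreal (N x powr (1 - ?n)) \<partial>lborel)
        = ennreal (A powr \<gamma>) * (\<integral>\<^sup>+x. ennreal (N x powr (1 - ?n)) \<partial>lborel)"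
    proof (rule nn_integral_cmult)
      have "continuous_on UNIV N" using N' by (rule continuous_on_has_derivative)
      then have [measurable]: "N \<in> borel_measurable borel" by (rule borel_measurable_continuous_onI)
      show "(\<lambda>x. ennreal (N x powr (1 - ?n))) \<in> borel_measurable lborel" by measurable
    qed
    ultimately show ?thesis by (auto simp: ennreal_mult_less_top elim!: order.strict_trans1)
  qed
  ultimately show ?thesis by blast
qed

section \<open>Gradient and divergence in coordinates\<close>

lemma sum_Basis_vec: "(\<Sum>b\<in>(Basis :: (real^'n) set). f b) = (\<Sum>i\<in>UNIV. f (axis i 1))"
proof -
  have B: "(Basis :: (real^'n) set) = (\<lambda>i. axis i 1) ` UNIV" by (auto simp: Basis_vec_def)
  have inj: "inj (\<lambda>i::'n. axis i (1::real))" by (auto simp: inj_def axis_eq_axis)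
  show ?thesis unfolding B sum.reindex[OF inj] by simp
qed

lemma grad_eqI:
  fixes u :: "real^'n \<Rightarrow> real"
  assumes "(u has_derivative (\<lambda>v. a \<bullet> v)) (at x)"
  shows "grad u x = a"
  using frechet_derivative_at[OF assms, symmetric] by (simp add: grad_def vec_eq_iff inner_axis)

lemma has_derivative_grad:
  fixes u :: "real^'n \<Rightarrow> real"
  assumes "u differentiable (at x)"
  shows "(u has_derivative (\<lambda>v. grad u x \<bullet> v)) (at x)"
proof -
  have D: "(u has_derivative frechet_derivative u (at x)) (at x)"
    using assms by (simp add: frechet_derivative_works)
  then have lin: "linear (frechet_derivative u (at x))" by (rule has_derivative_linear)
  have "frechet_derivative u (at x) v = grad u x \<bullet> v" for v
  proof -
    have "frechet_derivative u (at x) v = frechet_derivative u (at x) (\<Sum>b\<in>Basis. (v \<bullet> b) *\<^sub>R b)"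
      by (simp add: euclidean_representation)
    also have "\<dots> = (\<Sum>i\<in>UNIV. v $ i * frechet_derivative u (at x) (axis i 1))"
      by (simp add: linear_sum[OF lin] linear_scale[OF lin] sum_Basis_vec inner_axis)
    also have "\<dots> = grad u x \<bullet> v" by (simp add: grad_def inner_vec_def mult.commute)
    finally show ?thesis .
  qed
  then have "frechet_derivative u (at x) = (\<lambda>v. grad u x \<bullet> v)" by (rule ext)
  then show ?thesis using D by simp
qed

lemma divergence_eq:
  fixes V :: "real^'n \<Rightarrow> real^'n"
  assumes "(V has_derivative V') (at x)"
  shows "divergence V x = (\<Sum>b\<in>Basis. V' b \<bullet> b)"
  using frechet_derivative_at[OF assms, symmetric] by (simp add: divergence_def sum_Basis_vec inner_axis)

lemma gamma_laplace_solution_iff: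
  fixes u :: "real^'n \<Rightarrow> real"
  assumes "1 < \<gamma>"
  shows "positive_classical_solution \<gamma> p u \<longleftrightarrow> (\<exists>F'. gamma_laplace_solution u (grad u) (gamma_flux \<gamma> u) F' \<gamma> p)"
proof
  assume u: "positive_classical_solution \<gamma> p u"
  let ?F' = "\<lambda>x. frechet_derivative (gamma_flux \<gamma> u) (at x)"
  have F': "(gamma_flux \<gamma> u has_derivative ?F' x) (at x)" for x
    using u by (simp add: positive_classical_solution_def frechet_derivative_works)
  have "gamma_laplace_solution u (grad u) (gamma_flux \<gamma> u) ?F' \<gamma> p"
  proof
    show "(\<Sum>b\<in>Basis. ?F' x b \<bullet> b) = - (u x powr p)" for x
      using u divergence_eq[OF F'[of x]]
      by (simp add: positive_classical_solution_def gamma_laplacian_def) (metis minus_minus)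
    show "(u has_derivative (\<lambda>v. grad u x \<bullet> v)) (at x)" for x
      using u by (intro has_derivative_grad) (simp add: positive_classical_solution_def)
  qed (use u F' assms in \<open>auto simp: positive_classical_solution_def gamma_flux_def\<close>)
  then show "\<exists>F'. gamma_laplace_solution u (grad u) (gamma_flux \<gamma> u) F' \<gamma> p" by blast
next
  assume "\<exists>F'. gamma_laplace_solution u (grad u) (gamma_flux \<gamma> u) F' \<gamma> p"
  then obtain F' where "gamma_laplace_solution u (grad u) (gamma_flux \<gamma> u) F' \<gamma> p" by blast
  then interpret gamma_laplace_solution u "grad u" "gamma_flux \<gamma> u" F' \<gamma> p .
  show "positive_classical_solution \<gamma> p u"
    unfolding positive_classical_solution_def gamma_laplacian_def
    using pos u' F' by (auto simp: divergence_eq[OF F'] div_F differentiable_def)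
qed

theorem theorem1p4:
  fixes \<gamma> p :: real
  assumes "1 < \<gamma>" and "\<gamma> < real CARD('n::finite)" and "p > 0"
  shows "(\<exists>u :: real^'n \<Rightarrow> real.
            positive_classical_solution \<gamma> p u \<and>
            (\<integral>\<^sup>+ x. ennreal (norm (grad u x) powr \<gamma>) \<partial>lborel) < \<infinity>)
         \<longleftrightarrow> p = critical_sobolev_exponent CARD('n) \<gamma> - 1"
proof
  assume "\<exists>u :: real^'n \<Rightarrow> real. positive_classical_solution \<gamma> p u \<and>
            (\<integral>\<^sup>+ x. ennreal (norm (grad u x) powr \<gamma>) \<partial>lborel) < \<infinity>"
  then obtain u :: "real^'n \<Rightarrow> real" and F' where
    sol: "gamma_laplace_solution u (grad u) (gamma_flux \<gamma> u) F' \<gamma> p"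
    and energy: "(\<integral>\<^sup>+ x. ennreal (norm (grad u x) powr \<gamma>) \<partial>lborel) < \<infinity>"
    using gamma_laplace_solution_iff[OF assms(1)] by blast
  interpret gamma_laplace_solution u "grad u" "gamma_flux \<gamma> u" F' \<gamma> p by (rule sol)
  show "p = critical_sobolev_exponent CARD('n) \<gamma> - 1"
    using finite_energy_exponent[OF assms(3) _ energy] assms(2) by (simp add: critical_sobolev_exponent_def)
next
  assume p: "p = critical_sobolev_exponent CARD('n) \<gamma> - 1"
  then have "p = real DIM(real^'n) * \<gamma> / (real DIM(real^'n) - \<gamma>) - 1"
    by (simp add: critical_sobolev_exponent_def)
  with radial_solution_exists[where 'a = "real^'n", OF assms(1)] assms(2)
  obtain u :: "real^'n \<Rightarrow> real" and g F F' where sol: "gamma_laplace_solution u g F F' \<gamma> p"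
    and energy: "(\<integral>\<^sup>+x. ennreal (norm (g x) powr \<gamma>) \<partial>lborel) < \<infinity>" by auto
  interpret gamma_laplace_solution u g F F' \<gamma> p by (rule sol)
  have g: "grad u = g" using grad_eqI[OF u'] by auto
  have F: "gamma_flux \<gamma> u = F" by (auto simp: gamma_flux_def g F_eq)
  have "positive_classical_solution \<gamma> p u"
    using gamma_laplace_solution_iff[OF assms(1)] sol by (metis g F)
  then show "\<exists>u :: real^'n \<Rightarrow> real. positive_classical_solution \<gamma> p u \<and>
            (\<integral>\<^sup>+ x. ennreal (norm (grad u x) powr \<gamma>) \<partial>lborel) < \<infinity>"
    using energy g by auto
qed

end
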